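(* Let $n\geq 3$, let $\psi\in C(\mathbb{B}^n,\mathbb{R}^n)$ and suppose $|\psi(x)|\leq M(1-|x|^2)$ for all $x\in\mathbb{B}^n$, where $M$ is a constant. Let $1\leq k\leq n$ and $$u(x)=\int_{\mathbb{B}^n}G_h(x,y)\psi(y)\,d\tau(y).$$ Then $$\frac{\partial}{\partial x_k}u(x)=\int_{\mathbb{B}^n}\frac{\partial}{\partial x_k}G_h(x,y)\,\psi(y)\,d\tau(y),$$ and there exists a constant $\beta_1=\beta_1(n,M)$, depending only on $n$ and $M$, such that $$\left|\frac{\partial}{\partial x_k}u(x)\right|\leq\beta_1\qquad\text{for all }x\in\mathbb{B}^n.$$
   Context: $\mathbb{B}^n$ is the open unit ball of $\mathbb{R}^n$. $\nu$ is Lebesgue measure on $\mathbb{B}^n$ normalized so that $\nu(\mathbb{B}^n)=1$, and $d\tau(x)=(1-|x|^2)^{-n}\,d\nu(x)$. The hyperbolic Green function is $G_h(x,y)=g\left(\frac{|x-y|}{[x,y]}\right)$, where $[x,y]=\sqrt{1+|x|^2|y|^2-2\langle x,y\rangle}$ and $$g(r)=\int_r^1\frac{(1-t^2)^{n-2}}{t^{n-1}}\,dt,\qquad 0<r<1.$$ $\partial/\partial x_k$ acting on $G_h(x,y)$ is the partial derivative in the $k$-th coordinate of the first variable $x$. *)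

theory Defs
  imports "HOL-Analysis.Analysis"
begin

definition nu :: "(real ^ 'n) measure" where
  "nu = uniform_measure lebesgue (ball 0 1)"

text \<open>The measure lives on the whole space but is concentrated on the unit ball. Integrals against
  it are always written as set integrals over the ball, since the functions involved are only
  meaningful (and only known to be measurable) there.\<close>
definition tau :: "(real ^ 'n) measure" where
  "tau = density nu (\<lambda>x. ennreal (1 / (1 - (norm x)\<^sup>2) ^ CARD('n)))"

definition bracket :: "real ^ 'n \<Rightarrow> real ^ 'n \<Rightarrow> real" where
  "bracket x y = sqrt (1 + (norm x)\<^sup>2 * (norm y)\<^sup>2 - 2 * (x \<bullet> y))"

text \<open>The first argument is the dimension. Only \<open>0 < r < 1\<close> is meaningful; at \<open>r = 0\<close> the integral
  diverges if \<open>n \<ge> 2\<close>, so the value there is a convention.\<close>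
definition green_profile :: "nat \<Rightarrow> real \<Rightarrow> real" where
  "green_profile n r = integral {r..1} (\<lambda>t. (1 - t\<^sup>2) ^ (n - 2) / t ^ (n - 1))"

text \<open>The conventional value on the diagonal \<open>x = y\<close> affects the integrands in \<open>y\<close> only on a null set.\<close>
definition hyp_green :: "real ^ 'n \<Rightarrow> real ^ 'n \<Rightarrow> real" where
  "hyp_green x y = green_profile CARD('n) (norm (x - y) / bracket x y)"

definition green_potential :: "(real ^ 'n \<Rightarrow> real ^ 'n) \<Rightarrow> real ^ 'n \<Rightarrow> real ^ 'n" where
  "green_potential \<psi> x = (LINT y:ball 0 1|tau. hyp_green x y *\<^sub>R \<psi> y)"

definition has_partial_derivative ::
  "'n \<Rightarrow> (real ^ 'n \<Rightarrow> 'b::real_normed_vector) \<Rightarrow> real ^ 'n \<Rightarrow> bool" where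
  "has_partial_derivative k f x \<longleftrightarrow> (\<lambda>t. f (x + t *\<^sub>R axis k 1)) differentiable (at (0::real))"

definition partial_derivative ::
  "'n \<Rightarrow> (real ^ 'n \<Rightarrow> 'b::real_normed_vector) \<Rightarrow> real ^ 'n \<Rightarrow> 'b" where
  "partial_derivative k f x = vector_derivative (\<lambda>t. f (x + t *\<^sub>R axis k 1)) (at (0::real))"

end

theory Submission imports Defs begin

text \<open>
  Write \<open>a = |x - y|\<close>, \<open>b = [x,y]\<close>, \<open>p = 1 - |x|\<^sup>2\<close>, \<open>q = 1 - |y|\<^sup>2\<close> and let \<open>n\<close> be the dimension.
  Everything rests on the identity \<open>b\<^sup>2 = a\<^sup>2 + p q\<close>. With \<open>s = a\<^sup>2 / b\<^sup>2\<close> it gives \<open>1 - s = p q / b\<^sup>2\<close>,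
  and it gives the gradient estimate \<open>|\<partial>s| \<le> 12 a q / b\<^sup>3\<close>, which is small both on the diagonal and at
  the boundary (\<open>abs_pseudodist_sq_deriv_le\<close>). By the chain rule the derivative of the Green function
  is then at most a constant times \<open>p^(n-2) q^(n-1) / (b^(n-1) a^(n-1))\<close>. The factor \<open>q^(n-1)\<close> cancels
  against the density \<open>q^(-n)\<close> of \<open>\<tau>\<close> and the decay \<open>|\<psi>| \<le> M q\<close>.

  Uniform bound. Since \<open>b \<ge> max a (p/2)\<close>, what remains is at most a constant times
  \<open>p^(-n) W((y - x) / p)\<close>, where \<open>W(z) = |z|^(1-n) min(1, |z|^(1-n))\<close> is integrable over the whole space
  because \<open>n \<ge> 3\<close>. Rescaling by \<open>p\<close> removes \<open>x\<close> altogether, so the integral is bounded by a constant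
  depending on \<open>n\<close> and \<open>M\<close> only.

  Differentiation under the integral. Bounding a difference quotient of \<open>G(\<cdot>,y)\<close> by the supremum of the
  derivative over the segment from \<open>x\<close> to \<open>x + t e\<close> gives \<open>h^(1-n)\<close>, with \<open>h\<close> the distance of \<open>y\<close> from that segment,
  and this is not integrable. The difference is estimated through the radial profile \<open>g\<close> instead:
  as \<open>|g'|\<close> is decreasing, the quotient is controlled by the singularities at the two end points
  alone (\<open>abs_hyp_green_diff_le\<close>). The majorants obtained are \<open>W(y - x) + W(y - x - t e)\<close> up to a constant.
  They depend on \<open>t\<close>, but they converge as \<open>t \<rightarrow> 0\<close> and by translation invariance their integral is
  constant, so a version of dominated convergence with varying majorants applies
  (\<open>generalized_dominated_convergence\<close>).
\<close>

section \<open>Integration\<close>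

text \<open>Since the majorants have constant integral, Scheffe's lemma makes them converge in \<open>L\<^sup>1\<close>. Removing
  the excess \<open>|H i - h|\<close> from \<open>|F i - f|\<close> leaves a function below \<open>2 h\<close>, to which the usual dominated
  convergence theorem applies.\<close>

lemma generalized_dominated_convergence:
  fixes F :: "nat \<Rightarrow> 'a \<Rightarrow> 'b::{banach, second_countable_topology}" and H :: "nat \<Rightarrow> 'a \<Rightarrow> real"
  assumes [measurable]: "\<And>i. F i \<in> borel_measurable M" "f \<in> borel_measurable M"
    and H: "\<And>i. integrable M (H i)" "integrable M h"
    and H_nonneg: "\<And>i x. 0 \<le> H i x" "\<And>x. 0 \<le> h x"
    and F_lim: "AE x in M. (\<lambda>i. F i x) \<longlonglongrightarrow> f x"
    and H_lim: "AE x in M. (\<lambda>i. H i x) \<longlonglongrightarrow> h x"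
    and H_int: "\<And>i. integral\<^sup>L M (H i) = integral\<^sup>L M h"
    and bound: "\<And>i. AE x in M. norm (F i x) \<le> H i x"
  shows "integrable M f" "(\<lambda>i. integral\<^sup>L M (F i)) \<longlonglongrightarrow> integral\<^sup>L M f"
proof -
  have [measurable]: "H i \<in> borel_measurable M" "h \<in> borel_measurable M" for i
    using H by auto
  have bound': "AE x in M. \<forall>i. norm (F i x) \<le> H i x"
    using bound by (simp add: AE_all_countable)
  have f_le: "AE x in M. norm (f x) \<le> h x"
    using F_lim H_lim bound'
  proof eventually_elim
    case (elim x)
    show ?case by (rule LIMSEQ_le[OF tendsto_norm[OF elim(1)] elim(2)]) (use elim(3) in auto)
  qed
  show f: "integrable M f"
    by (rule Bochner_Integration.integrable_bound[OF H(2)]) (use f_le H_nonneg in auto)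
  have F: "integrable M (F i)" for i
    by (rule Bochner_Integration.integrable_bound[OF H(1)[of i]]) (use bound[of i] H_nonneg in auto)
  have "(\<lambda>i. \<integral>\<^sup>+ x. norm (H i x - h x) \<partial>M) \<longlonglongrightarrow> 0"
  proof (rule Scheffe_lemma2)
    show "(\<integral>\<^sup>+ x. norm (H i x) \<partial>M) \<le> (\<integral>\<^sup>+ x. norm (h x) \<partial>M)" for i
      using H H_nonneg H_int[of i] by (simp add: nn_integral_eq_integral)
  qed (use H H_lim in auto)
  moreover have "(\<integral>\<^sup>+ x. norm (H i x - h x) \<partial>M) = ennreal (\<integral>x. \<bar>H i x - h x\<bar> \<partial>M)" for i
    using H by (subst nn_integral_eq_integral) auto
  ultimately have L1: "(\<lambda>i. \<integral>x. \<bar>H i x - h x\<bar> \<partial>M) \<longlonglongrightarrow> 0"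
    by (simp add: ennreal_tendsto_0_iff)
  define E where "E i x = max 0 (norm (F i x - f x) - \<bar>H i x - h x\<bar>)" for i x
  have [measurable]: "E i \<in> borel_measurable M" for i unfolding E_def by measurable
  have E_le: "AE x in M. norm (E i x) \<le> 2 * h x" for i
    using f_le bound[of i]
  proof eventually_elim
    case (elim x)
    have "norm (F i x - f x) \<le> norm (F i x) + norm (f x)" by (rule norm_triangle_ineq4)
    then show ?case using elim H_nonneg(2)[of x] by (auto simp: E_def max_def)
  qed
  have E_lim: "AE x in M. (\<lambda>i. E i x) \<longlonglongrightarrow> 0"
    using F_lim H_lim
  proof eventually_elim
    case (elim x)
    have "(\<lambda>i. E i x) \<longlonglongrightarrow> max 0 (norm (f x - f x) - \<bar>h x - h x\<bar>)"
      unfolding E_def by (intro tendsto_intros elim)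
    then show ?case by simp
  qed
  have E: "(\<lambda>i. \<integral>x. E i x \<partial>M) \<longlonglongrightarrow> (\<integral>x. 0 \<partial>M)"
    by (rule integral_dominated_convergence[where w="\<lambda>x. 2 * h x"]) (use H E_le E_lim in auto)
  have E_int: "integrable M (E i)" for i
    by (rule Bochner_Integration.integrable_bound[of M "\<lambda>x. 2 * h x"])
      (use H E_le[of i] H_nonneg in auto)
  have "norm (integral\<^sup>L M (F i) - integral\<^sup>L M f)
      \<le> (\<integral>x. E i x \<partial>M) + (\<integral>x. \<bar>H i x - h x\<bar> \<partial>M)" for i
  proof -
    have "norm (integral\<^sup>L M (F i) - integral\<^sup>L M f) = norm (\<integral>x. F i x - f x \<partial>M)"
      using F f by simp
    also have "\<dots> \<le> (\<integral>x. norm (F i x - f x) \<partial>M)" by (rule integral_norm_bound)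
    also have "\<dots> \<le> (\<integral>x. E i x + \<bar>H i x - h x\<bar> \<partial>M)"
      using F f H E_int by (intro integral_mono) (auto simp: E_def)
    also have "\<dots> = (\<integral>x. E i x \<partial>M) + (\<integral>x. \<bar>H i x - h x\<bar> \<partial>M)"
      using E_int H by simp
    finally show ?thesis .
  qed
  moreover have "(\<lambda>i. (\<integral>x. E i x \<partial>M) + (\<integral>x. \<bar>H i x - h x\<bar> \<partial>M)) \<longlonglongrightarrow> 0"
    using tendsto_add[OF E L1] by simp
  ultimately have "(\<lambda>i. integral\<^sup>L M (F i) - integral\<^sup>L M f) \<longlonglongrightarrow> 0"
    by (intro Lim_null_comparison[of "\<lambda>i. integral\<^sup>L M (F i) - integral\<^sup>L M f"]) auto
  then show "(\<lambda>i. integral\<^sup>L M (F i)) \<longlonglongrightarrow> integral\<^sup>L M f"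
    by (simp add: LIM_zero_iff)
qed

lemma lborel_integral_rescale:
  fixes f :: "'a::euclidean_space \<Rightarrow> real"
  assumes f: "integrable lborel f" and c: "0 < c"
  shows "integrable lborel (\<lambda>y. f ((y - x) /\<^sub>R c))"
    and "(\<integral>y. f ((y - x) /\<^sub>R c) \<partial>lborel) = c ^ DIM('a) * integral\<^sup>L lborel f"
proof -
  have [measurable]: "f \<in> borel_measurable borel" using f by auto
  have eq: "lborel = density (distr lborel borel (\<lambda>z. x + c *\<^sub>R z)) (\<lambda>_. ennreal (c ^ DIM('a)))"
    using lborel_affine[of c x] c by simp
  show "integrable lborel (\<lambda>y. f ((y - x) /\<^sub>R c))"
    using f c by (subst eq, subst integrable_density) (auto simp: integrable_distr_eq)
  show "(\<integral>y. f ((y - x) /\<^sub>R c) \<partial>lborel) = c ^ DIM('a) * integral\<^sup>L lborel f"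
    using f c by (subst eq, subst integral_density) (auto simp: integral_distr)
qed

text \<open>This is \<open>|z|^(1-n) min(1, |z|^(1-n))\<close>: it has the singularity of a first derivative of the Newtonian
  kernel at the origin and decays like \<open>|z|^(2-2n)\<close>. Its value at the origin is 0.\<close>

definition cutoff_kernel :: "'a::euclidean_space \<Rightarrow> real" where
  "cutoff_kernel z = 1 / (norm z ^ (DIM('a) - 1) * max 1 (norm z) ^ (DIM('a) - 1))"

lemma cutoff_kernel_nonneg: "0 \<le> cutoff_kernel z"
  by (simp add: cutoff_kernel_def)

lemma cutoff_kernel_measurable [measurable]: "cutoff_kernel \<in> borel_measurable borel"
  unfolding cutoff_kernel_def by measurable

lemma isCont_cutoff_kernel: "z \<noteq> 0 \<Longrightarrow> isCont cutoff_kernel z"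
  unfolding cutoff_kernel_def by (intro continuous_intros) auto

lemma exists_dyadic_shell:
  fixes r :: real
  assumes "1 \<le> r"
  shows "\<exists>k::nat. 2 ^ k \<le> r \<and> r < 2 ^ (k + 1)"
proof -
  obtain m :: nat where m: "r < 2 ^ m" using real_arch_pow[of 2 r] by auto
  define l where "l = (LEAST m. r < 2 ^ m)"
  have l: "r < 2 ^ l" unfolding l_def by (rule LeastI[of _ m]) (rule m)
  then have "l \<noteq> 0" using assms by (cases "l = 0") auto
  then obtain k where k: "l = k + 1" by (metis Suc_eq_plus1 not0_implies_Suc)
  have "\<not> r < 2 ^ k" using not_less_Least[of k "\<lambda>m. r < 2 ^ m"] k by (simp add: l_def)
  with l k show ?thesis by (intro exI[of _ k]) auto
qed

text \<open>On the shell \<open>|z| \<approx> 2^(-k)\<close> the kernel is about \<open>2^(k(n-1))\<close> and the volume about \<open>2^(-kn)\<close>, a contribution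
  of \<open>2^(-k)\<close>; on the shell \<open>|z| \<approx> 2^k\<close> the contribution is \<open>2^(kn - 2k(n-1)) = 2^(-k(n-2))\<close>. Both series
  are geometric, the second one because \<open>n > 2\<close>.\<close>

lemma cutoff_kernel_integrable:
  assumes n: "3 \<le> DIM('a::euclidean_space)"
  shows "integrable lborel (cutoff_kernel :: 'a \<Rightarrow> real)"
proof -
  define m where "m = DIM('a) - 2"
  have m: "DIM('a) = m + 2" and m1: "1 \<le> m" using n by (simp_all add: m_def)
  define V where "V = unit_ball_vol (real DIM('a))"
  have V: "0 \<le> V" by (simp add: V_def unit_ball_vol_nonneg)
  define I :: "nat \<Rightarrow> 'a \<Rightarrow> ennreal" where
    "I k z = ennreal (2 ^ ((k + 1) * (m + 1))) * indicator (cball 0 (1 / 2 ^ k)) z" for k z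
  define J :: "nat \<Rightarrow> 'a \<Rightarrow> ennreal" where
    "J k z = ennreal (1 / 2 ^ (2 * k * (m + 1))) * indicator (cball 0 (2 ^ (k + 1))) z" for k z
  have [measurable]: "I k \<in> borel_measurable borel" "J k \<in> borel_measurable borel" for k
    unfolding I_def J_def
    by (auto intro!: borel_measurable_times_ennreal borel_measurable_indicator)
  have pw: "ennreal (cutoff_kernel z) \<le> (\<Sum>k. I k z + J k z)" for z :: 'a
  proof (cases "z = 0")
    case True
    then show ?thesis by (simp add: cutoff_kernel_def m)
  next
    case z: False
    have single: "I k z + J k z \<le> (\<Sum>k. I k z + J k z)" for k
      using sum_le_suminf[of "\<lambda>k. I k z + J k z" "{k}"] by (simp add: summableI)
    show ?thesis
    proof (cases "norm z \<le> 1")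
      case True
      then obtain k where k: "2 ^ k \<le> 1 / norm z" "1 / norm z < 2 ^ (k + 1)"
        using exists_dyadic_shell[of "1 / norm z"] z by auto
      have "cutoff_kernel z = (1 / norm z) ^ (m + 1)"
        using True by (simp add: cutoff_kernel_def m power_divide)
      also have "\<dots> \<le> (2 ^ (k + 1)) ^ (m + 1)"
        using k by (intro power_mono) auto
      finally have "cutoff_kernel z \<le> 2 ^ ((k + 1) * (m + 1))"
        by (simp only: power_mult)
      moreover have "norm z \<le> 1 / 2 ^ k" using k z by (simp add: field_simps)
      ultimately have "ennreal (cutoff_kernel z) \<le> I k z"
        by (simp add: I_def ennreal_leI del: ennreal_power)
      then show ?thesis using single[of k] by (meson add_increasing2 order.trans zero_le)
    next
      case False
      then obtain k where k: "2 ^ k \<le> norm z" "norm z < 2 ^ (k + 1)"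
        using exists_dyadic_shell[of "norm z"] by auto
      have "cutoff_kernel z = 1 / norm z ^ (2 * (m + 1))"
        using False by (simp add: cutoff_kernel_def m mult_2 power_add max_def)
      also have "\<dots> \<le> 1 / (2 ^ k) ^ (2 * (m + 1))"
        using k z by (intro frac_le power_mono zero_less_power) auto
      also have "(2 ^ k) ^ (2 * (m + 1)) = (2 ^ (2 * k * (m + 1)) :: real)"
        by (simp only: power_mult[symmetric] mult_ac)
      finally have "ennreal (cutoff_kernel z) \<le> J k z"
        using k by (simp add: J_def ennreal_leI del: ennreal_power)
      then show ?thesis using single[of k] by (meson add_increasing order.trans zero_le)
    qed
  qed
  have I_int: "(\<integral>\<^sup>+z. I k z \<partial>lborel) \<le> ennreal (2 ^ (m + 1) * V * (1 / 2) ^ k)" for k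
  proof -
    have "(\<integral>\<^sup>+z. I k z \<partial>lborel) = ennreal (2 ^ ((k + 1) * (m + 1))) * ennreal (V * (1 / 2 ^ k) ^ (m + 2))"
      unfolding I_def by (subst nn_integral_cmult_indicator) (simp_all add: emeasure_cball V_def m)
    also have "\<dots> = ennreal (2 ^ ((k + 1) * (m + 1)) * (V * (1 / 2 ^ k) ^ (m + 2)))"
      using V by (intro ennreal_mult[symmetric]) auto
    also have "2 ^ ((k + 1) * (m + 1)) * (V * (1 / 2 ^ k) ^ (m + 2)) = 2 ^ (m + 1) * V * (1 / 2) ^ k"
      proof -
      have "2 ^ ((k + 1) * (m + 1)) = (2 ^ k * 2 :: real) ^ (m + 1)"
        by (simp only: power_mult power_add power_one_right)
      also have "\<dots> * (V * (1 / 2 ^ k) ^ (m + 2)) = 2 ^ (m + 1) * V * (1 / 2 ^ k)"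
        unfolding power_mult_distrib power_divide power_one power_add[of "2 ^ k" m]
        by (simp add: power2_eq_square)
      finally show ?thesis by (simp only: power_divide power_one)
    qed
    finally show ?thesis by simp
  qed
  have J_int: "(\<integral>\<^sup>+z. J k z \<partial>lborel) \<le> ennreal (2 ^ (m + 2) * V * (1 / 2) ^ k)" for k
  proof -
    have "(\<integral>\<^sup>+z. J k z \<partial>lborel) = ennreal (1 / 2 ^ (2 * k * (m + 1))) * ennreal (V * (2 ^ (k + 1)) ^ (m + 2))"
      unfolding J_def by (subst nn_integral_cmult_indicator) (simp_all add: emeasure_cball V_def m)
    also have "\<dots> = ennreal (1 / 2 ^ (2 * k * (m + 1)) * (V * (2 ^ (k + 1)) ^ (m + 2)))"
      using V by (intro ennreal_mult[symmetric]) auto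
    also have "1 / 2 ^ (2 * k * (m + 1)) * (V * (2 ^ (k + 1)) ^ (m + 2)) = 2 ^ (m + 2) * V / 2 ^ (k * m)"
    proof -
      have "2 ^ (2 * k * (m + 1)) = (2 ^ k :: real) ^ (2 * (m + 1))"
        by (simp only: power_mult[symmetric] mult_ac)
      also have "2 * (m + 1) = (m + 2) + m" by simp
      finally have "2 ^ (2 * k * (m + 1)) = (2 ^ k :: real) ^ (m + 2) * 2 ^ (k * m)"
        by (simp only: power_add[of "2 ^ k" "m + 2"] power_mult)
      moreover have "(2 ^ (k + 1)) ^ (m + 2) = (2 ^ k :: real) ^ (m + 2) * 2 ^ (m + 2)"
        by (simp only: power_add[of 2 k 1] power_one_right power_mult_distrib)
      ultimately show ?thesis by simp
    qed
    also have "\<dots> \<le> 2 ^ (m + 2) * V / 2 ^ k"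
      using V m1 by (intro divide_left_mono power_increasing) auto
    also have "\<dots> = 2 ^ (m + 2) * V * (1 / 2) ^ k" by (simp add: power_divide)
    finally show ?thesis by (simp add: ennreal_leI)
  qed
  have "(\<integral>\<^sup>+z. ennreal (cutoff_kernel z) \<partial>(lborel :: 'a measure)) \<le> (\<integral>\<^sup>+z. (\<Sum>k. I k z + J k z) \<partial>lborel)"
    by (intro nn_integral_mono pw)
  also have "\<dots> = (\<Sum>k. (\<integral>\<^sup>+z. I k z \<partial>lborel) + (\<integral>\<^sup>+z. J k z \<partial>lborel))"
    by (simp add: nn_integral_suminf nn_integral_add)
  also have "\<dots> \<le> (\<Sum>k. ennreal (2 ^ (m + 1) * V * (1 / 2) ^ k) + ennreal (2 ^ (m + 2) * V * (1 / 2) ^ k))"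
    by (intro suminf_le add_mono I_int J_int) auto
  also have "\<dots> = (\<Sum>k. ennreal ((2 ^ (m + 1) * V + 2 ^ (m + 2) * V) * (1 / 2) ^ k))"
    using V by (simp add: ennreal_plus[symmetric] algebra_simps del: ennreal_plus)
  also have "\<dots> < \<infinity>"
    using V by (subst suminf_ennreal2) (auto intro!: summable_mult summable_geometric)
  finally have "(\<integral>\<^sup>+z. ennreal (norm (cutoff_kernel z)) \<partial>(lborel :: 'a measure)) < \<infinity>"
    by (simp add: cutoff_kernel_nonneg)
  then show ?thesis by (intro integrableI_bounded) auto
qed

text \<open>Two points of the unit ball have distance at most 2, and up to there the cutoff costs only a constant.\<close>

lemma inverse_power_norm_le_cutoff_kernel:
  fixes z :: "'a::euclidean_space"
  assumes "norm z \<le> 2"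
  shows "1 / norm z ^ (DIM('a) - 1) \<le> 2 ^ (DIM('a) - 1) * cutoff_kernel z"
proof -
  have "max 1 (norm z) ^ (DIM('a) - 1) \<le> 2 ^ (DIM('a) - 1)"
    using assms by (intro power_mono) auto
  then have "1 \<le> 2 ^ (DIM('a) - 1) / max 1 (norm z) ^ (DIM('a) - 1)"
    by (subst le_divide_eq_1_pos) (auto simp: less_max_iff_disj)
  then have "1 / norm z ^ (DIM('a) - 1) * 1 \<le>
      1 / norm z ^ (DIM('a) - 1) * (2 ^ (DIM('a) - 1) / max 1 (norm z) ^ (DIM('a) - 1))"
    by (rule mult_left_mono) simp
  then show ?thesis by (simp add: cutoff_kernel_def)
qed

section \<open>The bracket and the pseudo-hyperbolic distance\<close>

lemma bracket_nonneg: "0 \<le> bracket x y"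
proof -
  have "(x \<bullet> y)\<^sup>2 \<le> (norm x)\<^sup>2 * (norm y)\<^sup>2"
    using Cauchy_Schwarz_ineq[of x y] by (simp add: power2_norm_eq_inner)
  moreover have "0 \<le> (1 - x \<bullet> y)\<^sup>2" by simp
  ultimately show ?thesis
    unfolding bracket_def by (simp add: power2_eq_square algebra_simps)
qed

lemma bracket_power2: "(bracket x y)\<^sup>2 = 1 + (norm x)\<^sup>2 * (norm y)\<^sup>2 - 2 * (x \<bullet> y)"
  using bracket_nonneg[of x y] by (simp add: bracket_def)

lemma bracket_power2_eq_dist:
  "(bracket x y)\<^sup>2 = (norm (x - y))\<^sup>2 + (1 - (norm x)\<^sup>2) * (1 - (norm y)\<^sup>2)"
  by (simp add: bracket_power2 power2_norm_eq_inner algebra_simps inner_commute)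

lemma one_minus_norm_power2_pos: "norm x < 1 \<Longrightarrow> 0 < 1 - (norm x)\<^sup>2"
  for x :: "'a::real_normed_vector"
  by (simp add: power_less_one_iff abs_square_less_1)

lemma norm_diff_le_bracket:
  assumes "norm x \<le> 1" "norm y \<le> 1"
  shows "norm (x - y) \<le> bracket x y"
proof (rule power2_le_imp_le)
  have "0 \<le> (1 - (norm x)\<^sup>2) * (1 - (norm y)\<^sup>2)"
    using assms by (intro mult_nonneg_nonneg) (auto simp: power_le_one)
  then show "(norm (x - y))\<^sup>2 \<le> (bracket x y)\<^sup>2"
    by (simp add: bracket_power2_eq_dist)
qed (rule bracket_nonneg)

lemma one_minus_norms_le_bracket:
  assumes "norm x \<le> 1" "norm y \<le> 1"
  shows "1 - norm x * norm y \<le> bracket x y"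
proof (rule power2_le_imp_le)
  have "x \<bullet> y \<le> norm x * norm y" by (rule norm_cauchy_schwarz)
  then show "(1 - norm x * norm y)\<^sup>2 \<le> (bracket x y)\<^sup>2"
    unfolding bracket_power2 by (simp add: power2_eq_square algebra_simps)
qed (rule bracket_nonneg)

lemma one_minus_norm_le_bracket:
  assumes "norm x \<le> 1" "norm y \<le> 1"
  shows "1 - norm x \<le> bracket x y"
  using one_minus_norms_le_bracket[OF assms] mult_left_le[of "norm y" "norm x"] assms by simp

lemma one_minus_norm_power2_le_bracket:
  assumes "norm x \<le> 1" "norm y \<le> 1"
  shows "1 - (norm x)\<^sup>2 \<le> 2 * bracket x y"
proof -
  have "1 - (norm x)\<^sup>2 = (1 + norm x) * (1 - norm x)"
    by (simp add: power2_eq_square algebra_simps)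
  also have "\<dots> \<le> 2 * (1 - norm x)"
    using assms by (intro mult_right_mono) auto
  finally show ?thesis using one_minus_norm_le_bracket[OF assms] by simp
qed

lemma bracket_pos: "norm x < 1 \<Longrightarrow> norm y \<le> 1 \<Longrightarrow> 0 < bracket x y"
  using one_minus_norm_le_bracket[of x y] by simp

lemma bracket_le_2:
  assumes "norm x \<le> 1" "norm y \<le> 1"
  shows "bracket x y \<le> 2"
proof (rule power2_le_imp_le)
  have "- (x \<bullet> y) \<le> norm x * norm y"
    using norm_cauchy_schwarz[of "-x" y] by simp
  moreover have "norm x * norm y \<le> 1" using assms by (simp add: mult_le_one)
  moreover have "(norm x)\<^sup>2 * (norm y)\<^sup>2 \<le> 1"
    using assms by (simp add: mult_le_one power_le_one)
  ultimately show "(bracket x y)\<^sup>2 \<le> 2\<^sup>2"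
    unfolding bracket_power2 by simp
qed simp

text \<open>The vector on the left is half the gradient of \<open>b\<^sup>2\<close> in \<open>x\<close>; its norm is exactly \<open>|y| b\<close>.\<close>

lemma norm_scaleR_minus_le_bracket:
  assumes "norm y \<le> 1"
  shows "norm ((norm y)\<^sup>2 *\<^sub>R x - y) \<le> bracket x y"
proof (rule power2_le_imp_le)
  have "(norm ((norm y)\<^sup>2 *\<^sub>R x - y))\<^sup>2 = (norm y)\<^sup>2 * (bracket x y)\<^sup>2"
    unfolding bracket_power2 unfolding power2_norm_eq_inner
    by (simp add: algebra_simps inner_commute power2_eq_square)
  also have "\<dots> \<le> 1 * (bracket x y)\<^sup>2"
    using assms by (intro mult_right_mono) (auto simp: power_le_one)
  finally show "(norm ((norm y)\<^sup>2 *\<^sub>R x - y))\<^sup>2 \<le> (bracket x y)\<^sup>2" by simp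
qed (rule bracket_nonneg)

text \<open>The square of the pseudo-hyperbolic distance. Unlike the distance itself it is smooth also on the
  diagonal, so that it can be differentiated along segments that pass through \<open>y\<close>.\<close>

definition pseudodist_sq :: "real ^ 'n \<Rightarrow> real ^ 'n \<Rightarrow> real" where
  "pseudodist_sq x y = (norm (x - y))\<^sup>2 / (bracket x y)\<^sup>2"

definition pseudodist_sq_deriv :: "real ^ 'n \<Rightarrow> real ^ 'n \<Rightarrow> real ^ 'n \<Rightarrow> real" where
  "pseudodist_sq_deriv x y e =
     (2 * ((x - y) \<bullet> e) * (bracket x y)\<^sup>2
      - (norm (x - y))\<^sup>2 * (2 * (((norm y)\<^sup>2 *\<^sub>R x - y) \<bullet> e))) / (bracket x y) ^ 4"

lemma one_minus_pseudodist_sq: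
  assumes "norm x < 1" "norm y \<le> 1"
  shows "1 - pseudodist_sq x y = (1 - (norm x)\<^sup>2) * (1 - (norm y)\<^sup>2) / (bracket x y)\<^sup>2"
  using bracket_pos[OF assms] bracket_power2_eq_dist[of x y]
  by (simp add: pseudodist_sq_def field_simps)

lemma has_derivative_pseudodist_sq:
  assumes "norm (x + t *\<^sub>R e) < 1" "norm y \<le> 1"
  shows "((\<lambda>t. pseudodist_sq (x + t *\<^sub>R e) y)
           has_real_derivative pseudodist_sq_deriv (x + t *\<^sub>R e) y e) (at t)"
proof -
  let ?z = "\<lambda>t. x + t *\<^sub>R e"
  have "(norm (?z t - y))\<^sup>2 = (norm (x - y))\<^sup>2 + 2 * t * ((x - y) \<bullet> e) + t\<^sup>2 * (e \<bullet> e)" for t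
    unfolding power2_norm_eq_inner by (simp add: algebra_simps inner_commute power2_eq_square)
  then have A: "((\<lambda>t. (norm (?z t - y))\<^sup>2) has_real_derivative 2 * ((?z t - y) \<bullet> e)) (at t)"
    by (simp only:) (auto intro!: derivative_eq_intros simp: algebra_simps)
  have "(bracket (?z t) y)\<^sup>2 = 1 + ((norm x)\<^sup>2 + 2 * t * (x \<bullet> e) + t\<^sup>2 * (e \<bullet> e)) * (norm y)\<^sup>2
      - 2 * (x \<bullet> y) - 2 * t * (y \<bullet> e)" for t
    unfolding bracket_power2 unfolding power2_norm_eq_inner
    by (simp add: algebra_simps inner_commute power2_eq_square)
  then have B: "((\<lambda>t. (bracket (?z t) y)\<^sup>2) has_real_derivative
      2 * (((norm y)\<^sup>2 *\<^sub>R ?z t - y) \<bullet> e)) (at t)"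
    by (simp only:) (auto intro!: derivative_eq_intros simp: algebra_simps)
  have "(bracket (?z t) y) ^ 4 = (bracket (?z t) y)\<^sup>2 * (bracket (?z t) y)\<^sup>2"
    by (simp add: power_add[symmetric])
  then show ?thesis
    unfolding pseudodist_sq_def pseudodist_sq_deriv_def
    using DERIV_divide[OF A B] bracket_pos[OF assms] by (simp add: algebra_simps)
qed

text \<open>Two bounds for the numerator are combined: \<open>4 a b\<^sup>2\<close>, which detects the diagonal, and \<open>6 q b\<^sup>2\<close>, which
  detects the boundary. If \<open>b \<le> 2 a\<close> the second one already contains the factor \<open>a\<close> up to \<open>b\<close>; otherwise
  \<open>p q = b\<^sup>2 - a\<^sup>2\<close> is comparable to \<open>b\<^sup>2\<close> and \<open>p \<le> 2 b\<close>, which makes \<open>q\<close> at least comparable to \<open>b\<close>, so the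
  first one contains the factor \<open>q\<close> up to \<open>b\<close>.\<close>

lemma abs_pseudodist_sq_deriv_le:
  assumes x: "norm x < 1" and y: "norm y < 1" and e: "norm e = 1"
  shows "\<bar>pseudodist_sq_deriv x y e\<bar>
           \<le> 12 * norm (x - y) * (1 - (norm y)\<^sup>2) / (bracket x y) ^ 3"
proof -
  define a where "a = norm (x - y)"
  define b where "b = bracket x y"
  define p where "p = 1 - (norm x)\<^sup>2"
  define q where "q = 1 - (norm y)\<^sup>2"
  define X where "X = (x - y) \<bullet> e"
  define Y where "Y = ((norm y)\<^sup>2 *\<^sub>R x - y) \<bullet> e"
  have b: "0 < b" and ab: "a \<le> b" and pb: "p \<le> 2 * b" and a0: "0 \<le> a"
    and p: "0 < p" and q: "0 < q"
    using bracket_pos[of x y] norm_diff_le_bracket[of x y] one_minus_norm_power2_le_bracket[of x y]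
      one_minus_norm_power2_pos[of x] one_minus_norm_power2_pos[of y] x y
    by (simp_all add: a_def b_def p_def q_def)
  have b2: "b\<^sup>2 = a\<^sup>2 + p * q"
    by (simp add: a_def b_def p_def q_def bracket_power2_eq_dist)
  have X: "\<bar>X\<bar> \<le> a"
    using Cauchy_Schwarz_ineq2[of "x - y" e] e by (simp add: X_def a_def)
  have Y: "\<bar>Y\<bar> \<le> b"
    using Cauchy_Schwarz_ineq2[of "(norm y)\<^sup>2 *\<^sub>R x - y" e] e
      norm_scaleR_minus_le_bracket[of y x] y by (simp add: Y_def b_def)
  have D: "pseudodist_sq_deriv x y e = (2 * X * b\<^sup>2 - a\<^sup>2 * (2 * Y)) / b ^ 4"
    by (simp add: pseudodist_sq_deriv_def X_def Y_def a_def b_def)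
  have near: "\<bar>2 * X * b\<^sup>2 - a\<^sup>2 * (2 * Y)\<bar> \<le> 4 * a * b\<^sup>2"
  proof -
    have "\<bar>2 * X * b\<^sup>2\<bar> \<le> 2 * a * b\<^sup>2" using X by (simp add: abs_mult mult_right_mono)
    moreover have "\<bar>a\<^sup>2 * (2 * Y)\<bar> \<le> 2 * (a * b) * b"
    proof -
      have "\<bar>a\<^sup>2 * (2 * Y)\<bar> = 2 * (a * a) * \<bar>Y\<bar>" by (simp add: abs_mult power2_eq_square)
      also have "\<dots> \<le> 2 * (a * b) * b"
        using a0 ab b Y by (intro mult_mono mult_nonneg_nonneg) auto
      finally show ?thesis .
    qed
    ultimately show ?thesis by (simp add: power2_eq_square algebra_simps)
  qed
  \<comment> \<open>\<open>X\<close> and \<open>Y\<close> differ by a multiple of \<open>q\<close>, so replacing \<open>a\<^sup>2\<close> by \<open>b\<^sup>2 - p q\<close> leaves only multiples of \<open>q\<close>.\<close>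
  have far: "\<bar>2 * X * b\<^sup>2 - a\<^sup>2 * (2 * Y)\<bar> \<le> 6 * q * b\<^sup>2"
  proof -
    have XY: "X - Y = q * (x \<bullet> e)"
      by (simp add: X_def Y_def q_def algebra_simps)
    have xe: "\<bar>x \<bullet> e\<bar> \<le> 1" using Cauchy_Schwarz_ineq2[of x e] e x by simp
    have "2 * X * b\<^sup>2 - a\<^sup>2 * (2 * Y) = 2 * b\<^sup>2 * (X - Y) + 2 * (p * q) * Y"
      unfolding b2 by (simp add: algebra_simps)
    then have eq: "2 * X * b\<^sup>2 - a\<^sup>2 * (2 * Y) = 2 * b\<^sup>2 * (q * (x \<bullet> e)) + 2 * (p * q) * Y"
      using XY by simp
    have "\<bar>2 * b\<^sup>2 * (q * (x \<bullet> e))\<bar> \<le> 2 * b\<^sup>2 * (q * 1)"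
      using q xe mult_left_le[of "\<bar>x \<bullet> e\<bar>" q] by (simp add: abs_mult mult_left_mono)
    moreover have "\<bar>2 * (p * q) * Y\<bar> \<le> 2 * (2 * b * q) * b"
    proof -
      have "\<bar>2 * (p * q) * Y\<bar> = 2 * (p * q) * \<bar>Y\<bar>" using p q by (simp add: abs_mult)
      also have "\<dots> \<le> 2 * (2 * b * q) * b"
        using p q pb b Y by (intro mult_mono mult_nonneg_nonneg) auto
      finally show ?thesis .
    qed
    ultimately show ?thesis unfolding eq by (simp add: power2_eq_square algebra_simps)
  qed
  have main: "\<bar>2 * X * b\<^sup>2 - a\<^sup>2 * (2 * Y)\<bar> \<le> 12 * a * q * b"
  proof (cases "b \<le> 2 * a")
    case True
    have "6 * q * b\<^sup>2 \<le> 6 * q * (b * (2 * a))"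
      using True b q by (simp add: power2_eq_square)
    with far show ?thesis by (simp add: algebra_simps)
  next
    case False
    have "3 * b\<^sup>2 \<le> 4 * (p * q)"
    proof -
      have "(2 * a)\<^sup>2 \<le> b\<^sup>2" using False a0 by (intro power_mono) auto
      then show ?thesis using b2 by (simp add: power_mult_distrib)
    qed
    also have "\<dots> \<le> 4 * (2 * b * q)" using pb q by (intro mult_left_mono mult_right_mono) auto
    finally have "3 * b \<le> 8 * q" using b by (simp add: power2_eq_square)
    then have "4 * a * b * (3 * b) \<le> 4 * a * b * (8 * q)"
      using a0 b by (intro mult_left_mono) auto
    moreover have "0 \<le> a * b * q" using a0 b q by simp
    ultimately have "4 * a * b\<^sup>2 \<le> 12 * a * q * b" by (simp add: power2_eq_square algebra_simps)
    with near show ?thesis by (rule order.trans)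
  qed
  have "\<bar>pseudodist_sq_deriv x y e\<bar> \<le> 12 * a * q * b / b ^ 4"
    unfolding D abs_divide using main b by (simp add: divide_right_mono)
  also have "\<dots> = 12 * a * q / b ^ 3" using b by (simp add: power_eq_if)
  finally show ?thesis by (simp add: a_def b_def q_def)
qed

section \<open>Estimates for the hyperbolic Green function\<close>

lemma green_integrand_continuous:
  assumes "0 < a"
  shows "continuous_on {a..b} (\<lambda>t::real. (1 - t\<^sup>2) ^ (n - 2) / t ^ (n - 1))"
  using assms by (auto intro!: continuous_intros)

lemma green_integrand_antimono:
  fixes r t :: real
  assumes "0 < r" "r \<le> t" "t \<le> 1"
  shows "0 \<le> (1 - t\<^sup>2) ^ (n - 2) / t ^ (n - 1)"
    and "(1 - t\<^sup>2) ^ (n - 2) / t ^ (n - 1) \<le> (1 - r\<^sup>2) ^ (n - 2) / r ^ (n - 1)"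
proof -
  have 1: "0 \<le> 1 - t\<^sup>2" using assms by (simp add: power_le_one)
  then show "0 \<le> (1 - t\<^sup>2) ^ (n - 2) / t ^ (n - 1)"
    using assms by simp
  have 2: "r\<^sup>2 \<le> t\<^sup>2" using assms by (intro power_mono) auto
  with 1 have "0 \<le> 1 - r\<^sup>2" by simp
  with 1 2 assms show "(1 - t\<^sup>2) ^ (n - 2) / t ^ (n - 1) \<le> (1 - r\<^sup>2) ^ (n - 2) / r ^ (n - 1)"
    by (intro frac_le power_mono) auto
qed

lemma has_derivative_green_profile:
  assumes "0 < r" "r < 1"
  shows "(green_profile n has_real_derivative - ((1 - r\<^sup>2) ^ (n - 2) / r ^ (n - 1))) (at r)"
proof -
  have "((\<lambda>u. integral {u..1} (\<lambda>t. (1 - t\<^sup>2) ^ (n - 2) / t ^ (n - 1)))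
          has_vector_derivative - ((1 - r\<^sup>2) ^ (n - 2) / r ^ (n - 1))) (at r within {r/2..1})"
    using assms by (intro integral_has_vector_derivative' green_integrand_continuous) auto
  then have "((\<lambda>u. green_profile n u)
          has_real_derivative - ((1 - r\<^sup>2) ^ (n - 2) / r ^ (n - 1))) (at r within {r/2..1})"
    by (simp add: green_profile_def has_real_derivative_iff_has_vector_derivative)
  moreover have "at r within {r/2..1} = at r"
    using assms by (intro at_within_Icc_at) auto
  ultimately show ?thesis by simp
qed

text \<open>The integrand of the profile is decreasing, so on \<open>[r, s]\<close> it is largest at \<open>r\<close>.\<close>

lemma green_profile_diff_le:
  assumes "0 < r" "r \<le> s" "s \<le> 1"
  shows "\<bar>green_profile n r - green_profile n s\<bar> \<le> (1 - r\<^sup>2) ^ (n - 2) / r ^ (n - 1) * (s - r)"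
proof -
  let ?f = "\<lambda>t::real. (1 - t\<^sup>2) ^ (n - 2) / t ^ (n - 1)"
  have "?f integrable_on {r..1}"
    using assms by (intro integrable_continuous_real green_integrand_continuous)
  then have "integral {r..s} ?f + integral {s..1} ?f = integral {r..1} ?f"
    using assms by (intro Henstock_Kurzweil_Integration.integral_combine) auto
  then have "green_profile n r - green_profile n s = integral {r..s} ?f"
    by (simp add: green_profile_def)
  moreover have "norm (integral {r..s} ?f) \<le> ?f r * (s - r)"
  proof (intro integral_bound green_integrand_continuous ballI)
    fix t assume t: "t \<in> {r..s}"
    with assms have "0 \<le> ?f t" "?f t \<le> ?f r"
      by (intro green_integrand_antimono[of r t n]; simp)+
    then show "norm (?f t) \<le> ?f r" by (simp only: real_norm_def abs_of_nonneg)
  qed (use assms in auto)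
  ultimately show ?thesis by simp
qed

lemma green_profile_1 [simp]: "green_profile n 1 = 0"
  by (simp add: green_profile_def)

lemma sqrt_pseudodist_sq: "sqrt (pseudodist_sq x y) = norm (x - y) / bracket x y"
  by (simp add: pseudodist_sq_def real_sqrt_divide bracket_nonneg)

lemma pseudodist_sq_bounds:
  assumes "norm x < 1" "norm y < 1" "x \<noteq> y"
  shows "0 < pseudodist_sq x y" "pseudodist_sq x y < 1"
proof -
  show "0 < pseudodist_sq x y"
    using bracket_pos[of x y] assms by (simp add: pseudodist_sq_def)
  have "0 < 1 - pseudodist_sq x y"
    using one_minus_pseudodist_sq[of x y] bracket_pos[of x y] assms
      one_minus_norm_power2_pos[of x] one_minus_norm_power2_pos[of y]
    by (simp del: diff_gt_0_iff_gt)
  then show "pseudodist_sq x y < 1" by simp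
qed

text \<open>The chain rule for \<open>g(\<surd>s)\<close>, as a closed formula whose continuity and size can be read off.\<close>

definition hyp_green_deriv :: "real ^ 'n \<Rightarrow> real ^ 'n \<Rightarrow> real ^ 'n \<Rightarrow> real" where
  "hyp_green_deriv x y e =
     - ((1 - pseudodist_sq x y) ^ (CARD('n) - 2) / sqrt (pseudodist_sq x y) ^ (CARD('n) - 1))
     * (pseudodist_sq_deriv x y e / (2 * sqrt (pseudodist_sq x y)))"

lemma hyp_green_eq: "hyp_green x y = green_profile CARD('n) (sqrt (pseudodist_sq x y))"
  for x y :: "real ^ 'n"
  by (simp add: hyp_green_def sqrt_pseudodist_sq)

lemma has_derivative_hyp_green:
  fixes x y e :: "real ^ 'n"
  assumes "norm x < 1" "norm y < 1" "x \<noteq> y"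
  shows "((\<lambda>t. hyp_green (x + t *\<^sub>R e) y) has_real_derivative hyp_green_deriv x y e) (at 0)"
proof -
  note s = pseudodist_sq_bounds[OF assms]
  have "((\<lambda>t. pseudodist_sq (x + t *\<^sub>R e) y) has_real_derivative pseudodist_sq_deriv x y e) (at 0)"
    using has_derivative_pseudodist_sq[of x 0 e y] assms by simp
  then have S: "((\<lambda>t. sqrt (pseudodist_sq (x + t *\<^sub>R e) y)) has_real_derivative
       pseudodist_sq_deriv x y e / (2 * sqrt (pseudodist_sq x y))) (at 0)"
    using s by (auto intro!: derivative_eq_intros simp: field_simps)
  have "(green_profile CARD('n) has_real_derivative
      - ((1 - (sqrt (pseudodist_sq x y))\<^sup>2) ^ (CARD('n) - 2)
          / sqrt (pseudodist_sq x y) ^ (CARD('n) - 1)))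
        (at (sqrt (pseudodist_sq (x + 0 *\<^sub>R e) y)))"
    using has_derivative_green_profile[of "sqrt (pseudodist_sq x y)" "CARD('n)"] s by simp
  from DERIV_chain2[OF this S] s show ?thesis
    by (simp add: hyp_green_eq hyp_green_deriv_def)
qed

text \<open>One of the factors \<open>a\<close> in the singularity \<open>(b/a)^n\<close> of the chain rule is absorbed by the factor \<open>a\<close> in the
  bound for the derivative of the squared distance.\<close>

lemma abs_hyp_green_deriv_le:
  fixes x y e :: "real ^ 'n"
  assumes n: "CARD('n) \<ge> 2" and x: "norm x < 1" and y: "norm y < 1" and xy: "x \<noteq> y"
    and e: "norm e = 1"
  shows "\<bar>hyp_green_deriv x y e\<bar> \<le>
     6 * (1 - (norm x)\<^sup>2) ^ (CARD('n) - 2) * (1 - (norm y)\<^sup>2) ^ (CARD('n) - 1)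
       / (bracket x y ^ (CARD('n) - 1) * norm (x - y) ^ (CARD('n) - 1))"
proof -
  obtain m where m: "CARD('n) = m + 2" using n nat_le_iff_add by (metis add.commute)
  define a where "a = norm (x - y)"
  define b where "b = bracket x y"
  define p where "p = 1 - (norm x)\<^sup>2"
  define q where "q = 1 - (norm y)\<^sup>2"
  define S where "S = pseudodist_sq_deriv x y e"
  have a: "0 < a" and b: "0 < b" and p: "0 < p" and q: "0 < q"
    using bracket_pos[of x y] one_minus_norm_power2_pos[of x] one_minus_norm_power2_pos[of y] x y xy
    by (simp_all add: a_def b_def p_def q_def)
  have S: "\<bar>S\<bar> \<le> 12 * a * q / b ^ 3"
    using abs_pseudodist_sq_deriv_le[OF x y e] by (simp add: S_def a_def b_def q_def)
  have s: "1 - pseudodist_sq x y = p * q / b\<^sup>2" "sqrt (pseudodist_sq x y) = a / b"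
    using one_minus_pseudodist_sq[of x y] x y
    by (simp_all add: sqrt_pseudodist_sq a_def b_def p_def q_def)
  have "\<bar>hyp_green_deriv x y e\<bar> = (p * q / b\<^sup>2) ^ m / (a / b) ^ (m + 1) * (\<bar>S\<bar> / (2 * (a / b)))"
    using a b p q by (simp add: hyp_green_deriv_def s m S_def[symmetric] abs_mult power_abs)
  also have "\<dots> \<le> (p * q / b\<^sup>2) ^ m / (a / b) ^ (m + 1) * ((12 * a * q / b ^ 3) / (2 * (a / b)))"
    using a b p q S by (intro mult_left_mono divide_right_mono) auto
  also have "\<dots> = 6 * p ^ m * q ^ (m + 1) / (b ^ (m + 1) * a ^ (m + 1))"
  proof -
    have "(b\<^sup>2) ^ m = b ^ m * b ^ m" by (simp add: power2_eq_square power_mult_distrib)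
    then show ?thesis
      using a b p q
      by (simp add: power_divide power_mult_distrib power2_eq_square power3_eq_cube field_simps)
  qed
  finally show ?thesis by (simp add: m a_def b_def p_def q_def)
qed

lemma norm_segment_le:
  fixes z e y :: "'a::real_normed_vector"
  assumes "0 \<le> \<theta>" "\<theta> \<le> 1"
  shows "norm (z + (\<theta> * t) *\<^sub>R e - y) \<le> norm (z - y) + norm (z + t *\<^sub>R e - y)"
proof -
  have "z + (\<theta> * t) *\<^sub>R e - y = (1 - \<theta>) *\<^sub>R (z - y) + \<theta> *\<^sub>R (z + t *\<^sub>R e - y)"
    by (simp add: algebra_simps)
  also have "norm \<dots> \<le> (1 - \<theta>) * norm (z - y) + \<theta> * norm (z + t *\<^sub>R e - y)"
    using assms by (intro norm_triangle_le) simp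
  also have "\<dots> \<le> 1 * norm (z - y) + 1 * norm (z + t *\<^sub>R e - y)"
    using assms by (intro add_mono mult_right_mono) auto
  finally show ?thesis by simp
qed

text \<open>A Lipschitz estimate for the distance with a constant proportional to \<open>q\<close>. Applied to the squared distance,
  the mean value theorem yields the factor \<open>a\<close> at some point of the segment; by convexity this is at most
  the sum of the distances of the end points from \<open>y\<close>, hence comparable to the sum of the two values of
  the square root, which is what factoring the difference of squares divides by.\<close>

lemma sqrt_pseudodist_sq_diff_le:
  fixes z e y :: "real ^ 'n"
  assumes \<delta>: "0 < \<delta>" and z: "norm z \<le> 1 - \<delta>" and w: "norm (z + t *\<^sub>R e) \<le> 1 - \<delta>"
    and y: "norm y < 1" and e: "norm e = 1" and zy: "z \<noteq> y"
  shows "\<bar>sqrt (pseudodist_sq (z + t *\<^sub>R e) y) - sqrt (pseudodist_sq z y)\<bar>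
           \<le> 24 * (1 - (norm y)\<^sup>2) * \<bar>t\<bar> / \<delta> ^ 3"
proof -
  let ?\<gamma> = "\<lambda>\<theta>. z + (\<theta> * t) *\<^sub>R e"
  let ?a = "norm (z - y) + norm (z + t *\<^sub>R e - y)"
  let ?r = "sqrt (pseudodist_sq z y)" and ?r' = "sqrt (pseudodist_sq (z + t *\<^sub>R e) y)"
  define q where "q = 1 - (norm y)\<^sup>2"
  have q: "0 < q" using one_minus_norm_power2_pos[OF y] by (simp add: q_def)
  have seg: "norm (?\<gamma> \<theta>) \<le> 1 - \<delta>" if "\<theta> \<in> {0..1}" for \<theta>
  proof -
    have "?\<gamma> \<theta> = (1 - \<theta>) *\<^sub>R z + \<theta> *\<^sub>R (z + t *\<^sub>R e)"
      by (simp add: algebra_simps)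
    then have "?\<gamma> \<theta> \<in> cball 0 (1 - \<delta>)"
      using convexD_alt[OF convex_cball, of z 0 "1 - \<delta>" "z + t *\<^sub>R e" \<theta>] that z w by simp
    then show ?thesis by simp
  qed
  have deriv: "((\<lambda>\<theta>. pseudodist_sq (?\<gamma> \<theta>) y) has_real_derivative
      pseudodist_sq_deriv (?\<gamma> \<theta>) y e * t) (at \<theta>)" if "\<theta> \<in> {0..1}" for \<theta>
  proof -
    have "((\<lambda>t. pseudodist_sq (z + t *\<^sub>R e) y) has_real_derivative
      pseudodist_sq_deriv (?\<gamma> \<theta>) y e) (at (\<theta> * t))"
      using has_derivative_pseudodist_sq[of z "\<theta> * t" e y] seg[OF that] \<delta> y by simp
    moreover have "((\<lambda>\<theta>. \<theta> * t) has_real_derivative t) (at \<theta>)"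
      by (auto intro!: derivative_eq_intros)
    ultimately show ?thesis by (rule DERIV_chain2)
  qed
  have bound: "\<bar>pseudodist_sq_deriv (?\<gamma> \<theta>) y e * t\<bar> \<le> 12 * ?a * q / \<delta> ^ 3 * \<bar>t\<bar>"
    if th: "\<theta> \<in> {0..1}" for \<theta>
  proof -
    have g1: "norm (?\<gamma> \<theta>) < 1" using seg[OF th] \<delta> by simp
    have "\<delta> \<le> bracket (?\<gamma> \<theta>) y"
      using one_minus_norm_le_bracket[of "?\<gamma> \<theta>" y] seg[OF th] \<delta> y by simp
    then have "12 * norm (?\<gamma> \<theta> - y) * q / bracket (?\<gamma> \<theta>) y ^ 3 \<le> 12 * ?a * q / \<delta> ^ 3"
      using q \<delta> th norm_segment_le[of \<theta> z t e y]
      by (intro frac_le mult_mono power_mono) auto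
    then have "\<bar>pseudodist_sq_deriv (?\<gamma> \<theta>) y e\<bar> \<le> 12 * ?a * q / \<delta> ^ 3"
      using abs_pseudodist_sq_deriv_le[OF g1 y e] by (simp add: q_def)
    then show ?thesis unfolding abs_mult by (rule mult_right_mono) simp
  qed
  have "norm (pseudodist_sq (?\<gamma> 1) y - pseudodist_sq (?\<gamma> 0) y) \<le> 12 * ?a * q / \<delta> ^ 3 * \<bar>t\<bar> * norm (1 - 0 :: real)"
    by (rule field_differentiable_bound[of "{0..1}" _ "\<lambda>\<theta>. pseudodist_sq_deriv (?\<gamma> \<theta>) y e * t"])
       (use deriv bound in \<open>auto intro: has_field_derivative_at_within\<close>)
  then have diff: "\<bar>pseudodist_sq (z + t *\<^sub>R e) y - pseudodist_sq z y\<bar> \<le> 12 * ?a * q / \<delta> ^ 3 * \<bar>t\<bar>"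
    by simp
  have z1: "norm z < 1" "norm (z + t *\<^sub>R e) < 1" using z w \<delta> by auto
  have a_le: "norm (v - y) / 2 \<le> sqrt (pseudodist_sq v y)" if "norm v < 1" for v
    unfolding sqrt_pseudodist_sq using bracket_le_2[of v y] bracket_pos[of v y] that y
    by (intro divide_left_mono) auto
  have sum: "?a \<le> 2 * (?r' + ?r)" using a_le[of z] a_le[of "z + t *\<^sub>R e"] z1 by simp
  have pos: "0 < ?r' + ?r"
    using sum zy by (smt (verit) norm_ge_zero zero_less_norm_iff right_minus_eq)
  have "\<bar>?r' - ?r\<bar> * (?r' + ?r) = \<bar>(?r' - ?r) * (?r' + ?r)\<bar>"
    using pos by (simp add: abs_mult)
  also have "(?r' - ?r) * (?r' + ?r) = pseudodist_sq (z + t *\<^sub>R e) y - pseudodist_sq z y"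
    by (simp add: algebra_simps pseudodist_sq_def)
  also have "\<bar>\<dots>\<bar> \<le> 12 * (2 * (?r' + ?r)) * q / \<delta> ^ 3 * \<bar>t\<bar>"
    by (rule order.trans[OF diff])
       (use q \<delta> sum in \<open>auto intro!: mult_right_mono divide_right_mono\<close>)
  also have "\<dots> = (24 * q * \<bar>t\<bar> / \<delta> ^ 3) * (?r' + ?r)" by (simp add: field_simps)
  finally have "\<bar>?r' - ?r\<bar> \<le> 24 * q * \<bar>t\<bar> / \<delta> ^ 3"
    using pos by (rule mult_right_le_imp_le)
  then show ?thesis by (simp only: q_def)
qed


text \<open>With \<open>i = n - 2\<close> and \<open>j = n - 1\<close> the left-hand side is the slope of the profile. The powers of \<open>1 - s\<close>
  carry the decay at the boundary, those of \<open>\<surd>s\<close> the singularity on the diagonal.\<close>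

lemma green_profile_slope_le:
  fixes v y :: "real ^ 'n"
  assumes \<delta>: "0 < \<delta>" and v: "norm v \<le> 1 - \<delta>" and y: "norm y < 1" and vy: "v \<noteq> y"
  shows "(1 - pseudodist_sq v y) ^ i / sqrt (pseudodist_sq v y) ^ j
     \<le> ((1 - (norm y)\<^sup>2) / \<delta>\<^sup>2) ^ i * (2 ^ j / norm (v - y) ^ j)"
proof -
  define q where "q = 1 - (norm y)\<^sup>2"
  have v1: "norm v < 1" using v \<delta> by simp
  have q: "0 < q" and p: "0 < 1 - (norm v)\<^sup>2"
    using one_minus_norm_power2_pos[OF y] one_minus_norm_power2_pos[OF v1] by (simp_all add: q_def)
  have b: "0 < bracket v y" "bracket v y \<le> 2" and \<delta>b: "\<delta> \<le> bracket v y"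
    using bracket_pos[of v y] bracket_le_2[of v y] one_minus_norm_le_bracket[of v y] v v1 y by auto
  have "(1 - (norm v)\<^sup>2) * q / (bracket v y)\<^sup>2 \<le> q / \<delta>\<^sup>2"
    using q p \<delta> \<delta>b by (intro frac_le power_mono) auto
  then have "((1 - (norm v)\<^sup>2) * q / (bracket v y)\<^sup>2) ^ i \<le> (q / \<delta>\<^sup>2) ^ i"
    using q p by (intro power_mono) auto
  moreover have "(bracket v y / norm (v - y)) ^ j \<le> (2 / norm (v - y)) ^ j"
    using b by (intro power_mono divide_right_mono) auto
  ultimately have "((1 - (norm v)\<^sup>2) * q / (bracket v y)\<^sup>2) ^ i * (bracket v y / norm (v - y)) ^ j
     \<le> (q / \<delta>\<^sup>2) ^ i * (2 / norm (v - y)) ^ j"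
    using q b by (intro mult_mono) auto
  then show ?thesis
    using one_minus_pseudodist_sq[of v y] v1 y
    by (simp add: sqrt_pseudodist_sq q_def power_divide)
qed

text \<open>The slope of the profile between two radii is largest at the smaller one. Which of the two points has
  the smaller radius depends on \<open>y\<close>, hence the sum of both singularities.\<close>

lemma abs_hyp_green_diff_le:
  fixes z e y :: "real ^ 'n"
  assumes \<delta>: "0 < \<delta>" and z: "norm z \<le> 1 - \<delta>" and w: "norm (z + t *\<^sub>R e) \<le> 1 - \<delta>"
    and y: "norm y < 1" and e: "norm e = 1" and zy: "z \<noteq> y" and wy: "z + t *\<^sub>R e \<noteq> y"
    and n: "CARD('n) \<ge> 2"
  shows "\<bar>hyp_green (z + t *\<^sub>R e) y - hyp_green z y\<bar> \<le>
    24 * 2 ^ (CARD('n) - 1) / (\<delta> ^ 3 * (\<delta>\<^sup>2) ^ (CARD('n) - 2)) * \<bar>t\<bar> * (1 - (norm y)\<^sup>2) ^ (CARD('n) - 1)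
      * (1 / norm (z - y) ^ (CARD('n) - 1) + 1 / norm (z + t *\<^sub>R e - y) ^ (CARD('n) - 1))"
proof -
  obtain m where m: "CARD('n) = m + 2" using n nat_le_iff_add by (metis add.commute)
  define q where "q = 1 - (norm y)\<^sup>2"
  define L where "L = 24 * q * \<bar>t\<bar> / \<delta> ^ 3"
  define K where "K v = (q / \<delta>\<^sup>2) ^ m * (2 ^ (m + 1) / norm (v - y) ^ (m + 1))" for v
  let ?r = "\<lambda>v. sqrt (pseudodist_sq v y)"
  have q: "0 < q" using one_minus_norm_power2_pos[OF y] by (simp add: q_def)
  have L: "0 \<le> L" and K: "0 \<le> K v" for v using q \<delta> by (simp_all add: L_def K_def)
  have one: "\<bar>hyp_green v y - hyp_green v' y\<bar> \<le> K v * L"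
    if v: "norm v \<le> 1 - \<delta>" "v \<noteq> y" and v': "norm v' \<le> 1 - \<delta>" "v' \<noteq> y"
      and le: "?r v \<le> ?r v'" and diff: "?r v' - ?r v \<le> L" for v v'
  proof -
    have v1: "norm v < 1" "norm v' < 1" using v v' \<delta> by auto
    note s = pseudodist_sq_bounds[OF v1(1) y v(2)] pseudodist_sq_bounds[OF v1(2) y v'(2)]
    have "\<bar>hyp_green v y - hyp_green v' y\<bar>
        \<le> (1 - (?r v)\<^sup>2) ^ m / ?r v ^ (m + 1) * (?r v' - ?r v)"
      using green_profile_diff_le[of "?r v" "?r v'" "m + 2"] s le by (simp add: hyp_green_eq m)
    also have "\<dots> = (1 - pseudodist_sq v y) ^ m / ?r v ^ (m + 1) * (?r v' - ?r v)"
      using s by simp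
    also have "\<dots> \<le> K v * L"
      using green_profile_slope_le[OF \<delta> v(1) y v(2), of m "m + 1"] le diff K[of v]
      by (intro mult_mono) (auto simp: K_def q_def)
    finally show ?thesis .
  qed
  have r_diff: "\<bar>?r (z + t *\<^sub>R e) - ?r z\<bar> \<le> L"
    using sqrt_pseudodist_sq_diff_le[OF \<delta> z w y e zy] by (simp only: L_def q_def)
  have "\<bar>hyp_green (z + t *\<^sub>R e) y - hyp_green z y\<bar> \<le> (K z + K (z + t *\<^sub>R e)) * L"
  proof (cases "?r z \<le> ?r (z + t *\<^sub>R e)")
    case True
    have "\<bar>hyp_green z y - hyp_green (z + t *\<^sub>R e) y\<bar> \<le> K z * L"
      by (rule one) (use True z w zy wy r_diff in auto)
    also have "\<dots> \<le> (K z + K (z + t *\<^sub>R e)) * L" using K L by (intro mult_right_mono) auto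
    finally show ?thesis by (simp only: abs_minus_commute)
  next
    case False
    have "\<bar>hyp_green (z + t *\<^sub>R e) y - hyp_green z y\<bar> \<le> K (z + t *\<^sub>R e) * L"
      by (rule one) (use False z w zy wy r_diff in auto)
    also have "\<dots> \<le> (K z + K (z + t *\<^sub>R e)) * L" using K L by (intro mult_right_mono) auto
    finally show ?thesis .
  qed
  also have "\<dots> = 24 * 2 ^ (m + 1) / (\<delta> ^ 3 * (\<delta>\<^sup>2) ^ m) * \<bar>t\<bar> * q ^ (m + 1)
      * (1 / norm (z - y) ^ (m + 1) + 1 / norm (z + t *\<^sub>R e - y) ^ (m + 1))"
    using \<delta> by (simp add: K_def L_def power_divide add_divide_distrib distrib_left distrib_right ac_simps)
  finally show ?thesis by (simp add: m q_def)
qed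

text \<open>The profile vanishes at 1, so this is a difference bound with \<open>1 - \<surd>s \<le> 1 - s\<close> supplying one further
  factor \<open>q\<close>.\<close>

lemma abs_hyp_green_le:
  fixes x y :: "real ^ 'n"
  assumes \<delta>: "0 < \<delta>" and x: "norm x \<le> 1 - \<delta>" and y: "norm y < 1" and xy: "x \<noteq> y"
    and n: "CARD('n) \<ge> 2"
  shows "\<bar>hyp_green x y\<bar> \<le> (2 / \<delta>\<^sup>2) ^ (CARD('n) - 1) * (1 - (norm y)\<^sup>2) ^ (CARD('n) - 1)
      * (1 / norm (x - y) ^ (CARD('n) - 1))"
proof -
  obtain m where m: "CARD('n) = m + 2" using n nat_le_iff_add by (metis add.commute)
  let ?r = "sqrt (pseudodist_sq x y)"
  have x1: "norm x < 1" using x \<delta> by simp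
  note s = pseudodist_sq_bounds[OF x1 y xy]
  have "?r * ?r \<le> 1 * ?r" using s by (intro mult_right_mono) auto
  then have r: "1 - ?r \<le> 1 - pseudodist_sq x y" using s by simp
  have "\<bar>hyp_green x y\<bar> \<le> (1 - (?r)\<^sup>2) ^ m / ?r ^ (m + 1) * (1 - ?r)"
    using green_profile_diff_le[of "?r" 1 "m + 2"] s by (simp add: hyp_green_eq m)
  also have "\<dots> \<le> (1 - pseudodist_sq x y) ^ m / ?r ^ (m + 1) * (1 - pseudodist_sq x y)"
    using r s by (intro mult_mono) auto
  also have "\<dots> = (1 - pseudodist_sq x y) ^ (m + 1) / ?r ^ (m + 1)" by simp
  also have "\<dots> \<le> ((1 - (norm y)\<^sup>2) / \<delta>\<^sup>2) ^ (m + 1) * (2 ^ (m + 1) / norm (x - y) ^ (m + 1))"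
    by (rule green_profile_slope_le[OF \<delta> x y xy])
  also have "\<dots> = (2 / \<delta>\<^sup>2) ^ (m + 1) * (1 - (norm y)\<^sup>2) ^ (m + 1) * (1 / norm (x - y) ^ (m + 1))"
    by (simp only: power_divide) (simp add: ac_simps)
  finally show ?thesis by (simp add: m)
qed

section \<open>Integrals against the invariant measure\<close>

lemma has_vector_derivative_if_quotient_tendsto:
  fixes f :: "real \<Rightarrow> 'b::real_normed_vector"
  assumes "((\<lambda>t. (f t - f 0) /\<^sub>R t) \<longlongrightarrow> v) (at 0)"
  shows "(f has_vector_derivative v) (at 0)"
proof -
  have "((\<lambda>t. norm ((f t - f 0) /\<^sub>R t - v)) \<longlongrightarrow> 0) (at 0)"
    using assms by (intro tendsto_norm_zero LIM_zero)
  moreover have "\<forall>\<^sub>F t in at 0. norm ((f t - f 0) /\<^sub>R t - v) = norm (f (0 + t) - f 0 - t *\<^sub>R v) / norm t"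
    unfolding eventually_at_filter
  proof (intro always_eventually allI impI)
    fix t :: real assume t: "t \<noteq> 0"
    have "(f t - f 0) /\<^sub>R t - v = (f t - f 0 - t *\<^sub>R v) /\<^sub>R t"
      using t by (simp add: scaleR_diff_right)
    then show "norm ((f t - f 0) /\<^sub>R t - v) = norm (f (0 + t) - f 0 - t *\<^sub>R v) / norm t"
      by (simp add: divide_inverse_commute)
  qed
  ultimately have "((\<lambda>t. norm (f (0 + t) - f 0 - t *\<^sub>R v) / norm t) \<longlongrightarrow> 0) (at 0)"
    by (rule Lim_transform_eventually)
  then show ?thesis
    by (simp add: has_vector_derivative_def has_derivative_at bounded_linear_scaleR_left)
qed

text \<open>The density of the invariant measure with respect to Lebesgue measure; the indicator makes it
  nonnegative also outside the ball, where the formula may change sign.\<close>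

definition tau_density :: "real ^ 'n \<Rightarrow> real" where
  "tau_density y = indicator (ball 0 1) y
     / (measure lborel (ball 0 1 :: (real ^ 'n) set) * (1 - (norm y)\<^sup>2) ^ CARD('n))"

lemma measure_unit_ball_pos: "0 < measure lborel (ball 0 1 :: (real ^ 'n) set)"
  by (simp add: content_ball_pos)

lemma tau_density_nonneg: "0 \<le> tau_density y"
  using measure_unit_ball_pos one_minus_norm_power2_pos[of y]
  by (auto simp: tau_density_def indicator_def intro!: divide_nonneg_nonneg mult_nonneg_nonneg zero_le_power)

lemma tau_density_measurable [measurable]: "tau_density \<in> borel_measurable borel"
proof -
  have [measurable]: "ball 0 1 \<in> sets (borel :: (real ^ 'n) measure)" by simp
  show "(tau_density :: real ^ 'n \<Rightarrow> real) \<in> borel_measurable borel"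
    unfolding tau_density_def by measurable
qed

lemma tau_eq_density: "(tau :: (real ^ 'n) measure) = density lebesgue (\<lambda>y. ennreal (tau_density y))"
proof -
  let ?B = "ball 0 1 :: (real ^ 'n) set"
  let ?w = "\<lambda>x :: real ^ 'n. ennreal (1 / (1 - (norm x)\<^sup>2) ^ CARD('n))"
  have w: "?w \<in> borel_measurable lebesgue" by (intro measurable_completion) measurable
  have [measurable]: "?B \<in> sets borel" by simp
  have i: "(\<lambda>x. indicator ?B x / emeasure lebesgue ?B) \<in> borel_measurable lebesgue"
    unfolding divide_ennreal_def by (intro measurable_completion) measurable
  have e: "emeasure lebesgue ?B = ennreal (measure lborel ?B)"
    using emeasure_eq_ennreal_measure[of lborel ?B] emeasure_lborel_ball_finite[of "0 :: real ^ 'n" 1]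
    by (simp add: less_top)
  have "indicator ?B x / emeasure lebesgue ?B * ?w x = ennreal (tau_density x)" for x
    using measure_unit_ball_pos one_minus_norm_power2_pos[of x] unfolding e
    by (auto simp: tau_density_def indicator_def divide_ennreal ennreal_mult[symmetric]
        simp flip: ennreal_1)
  then show ?thesis
    unfolding tau_def nu_def uniform_measure_def by (subst density_density_eq[OF i w]) simp
qed

text \<open>From here on integrals are taken with respect to Lebesgue measure on the Borel sets, where translation and
  scaling are available; for Borel functions the completion makes no difference.\<close>

lemma set_integral_tau:
  fixes f :: "real ^ 'n \<Rightarrow> 'b::{banach, second_countable_topology}"
  assumes f: "(\<lambda>y. indicator (ball 0 1) y *\<^sub>R f y) \<in> borel_measurable borel"
  shows "set_integrable tau (ball 0 1) f \<longleftrightarrow> integrable lborel (\<lambda>y. tau_density y *\<^sub>R f y)"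
    and "(LINT y:ball 0 1|tau. f y) = (\<integral>y. tau_density y *\<^sub>R f y \<partial>lborel)"
    and "(\<lambda>y. tau_density y *\<^sub>R f y) \<in> borel_measurable borel"
proof -
  have eq: "tau_density y *\<^sub>R (indicator (ball 0 1) y *\<^sub>R f y) = tau_density y *\<^sub>R f y" for y
    by (auto simp: tau_density_def indicator_def)
  then have eq': "(tau_density y * indicator (ball 0 1) y) *\<^sub>R f y = tau_density y *\<^sub>R f y" for y
    by simp
  have "(\<lambda>y. tau_density y *\<^sub>R (indicator (ball 0 1) y *\<^sub>R f y)) \<in> borel_measurable borel"
    using f by measurable
  then show m: "(\<lambda>y. tau_density y *\<^sub>R f y) \<in> borel_measurable borel" by (simp only: eq)
  have f': "(\<lambda>y. indicator (ball 0 1) y *\<^sub>R f y) \<in> borel_measurable lebesgue"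
    and d: "tau_density \<in> borel_measurable (lebesgue :: (real ^ 'n) measure)"
    using f by (auto intro!: measurable_completion)
  show "set_integrable tau (ball 0 1) f \<longleftrightarrow> integrable lborel (\<lambda>y. tau_density y *\<^sub>R f y)"
    unfolding set_integrable_def tau_eq_density
    using integrable_density[OF f' d AE_I2[OF tau_density_nonneg]] m by (simp add: eq' integrable_completion)
  show "(LINT y:ball 0 1|tau. f y) = (\<integral>y. tau_density y *\<^sub>R f y \<partial>lborel)"
    unfolding set_lebesgue_integral_def tau_eq_density
    using integral_density[OF f' d AE_I2[OF tau_density_nonneg]] m by (simp add: eq' integral_completion)
qed

text \<open>The cancellation of boundary weights: \<open>q^(n-1)\<close> from the kernel and \<open>q\<close> from the function \<open>\<psi>\<close> compensate
  the density \<open>q^(-n)\<close>.\<close>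

lemma norm_tau_density_scaleR_le:
  fixes y v :: "real ^ 'n"
  assumes k: "norm y < 1 \<Longrightarrow> \<bar>k\<bar> \<le> (1 - (norm y)\<^sup>2) ^ (CARD('n) - 1) * H"
    and v: "norm y < 1 \<Longrightarrow> norm v \<le> M * (1 - (norm y)\<^sup>2)" and "0 \<le> M" "0 \<le> H"
  shows "norm (tau_density y *\<^sub>R (k *\<^sub>R v)) \<le> M / measure lborel (ball 0 1 :: (real ^ 'n) set) * H"
proof (cases "norm y < 1")
  case True
  define q where "q = 1 - (norm y)\<^sup>2"
  define V where "V = measure lborel (ball 0 1 :: (real ^ 'n) set)"
  have q: "0 < q" and V: "0 < V"
    using True one_minus_norm_power2_pos[of y] measure_unit_ball_pos by (auto simp: q_def V_def)
  have "CARD('n) = Suc (CARD('n) - 1)" by simp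
  then have qn: "q ^ CARD('n) = q ^ (CARD('n) - 1) * q" by (metis power_Suc2)
  have "norm (tau_density y *\<^sub>R (k *\<^sub>R v)) = 1 / (V * q ^ CARD('n)) * (\<bar>k\<bar> * norm v)"
    using True q V by (simp add: tau_density_def q_def[symmetric] V_def[symmetric] abs_mult)
  also have "\<dots> \<le> 1 / (V * q ^ CARD('n)) * ((q ^ (CARD('n) - 1) * H) * (M * q))"
    using k v True q V assms(3,4) by (intro mult_left_mono mult_mono) (auto simp: q_def)
  also have "\<dots> = M / V * H" unfolding qn using q V by (simp add: field_simps)
  finally show ?thesis by (simp add: V_def)
next
  case False
  then have "tau_density y = 0" by (simp add: tau_density_def)
  then show ?thesis using assms(3,4) by simp
qed

lemma continuous_on_pseudodist_sq:
  assumes "norm x < 1"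
  shows "continuous_on (ball 0 1) (\<lambda>y. pseudodist_sq x y)"
proof -
  have "bracket x y \<noteq> 0" if "y \<in> ball 0 1" for y
    using bracket_pos[of x y] assms that by auto
  then show ?thesis
    unfolding pseudodist_sq_def bracket_def
    by (intro continuous_intros) auto
qed

lemma continuous_on_hyp_green:
  fixes x :: "real ^ 'n"
  assumes x: "norm x < 1"
  shows "continuous_on (ball 0 1 - {x}) (\<lambda>y. hyp_green x y)"
proof -
  have "continuous_on {0<..<1} (green_profile CARD('n))"
    by (intro continuous_at_imp_continuous_on ballI DERIV_isCont[OF has_derivative_green_profile]) auto
  moreover have "continuous_on (ball 0 1 - {x}) (\<lambda>y. sqrt (pseudodist_sq x y))"
    using continuous_on_subset[OF continuous_on_pseudodist_sq[OF x]]
    by (intro continuous_intros) auto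
  moreover have "sqrt (pseudodist_sq x y) \<in> {0<..<1}" if "y \<in> ball 0 1 - {x}" for y
    using pseudodist_sq_bounds[of x y] x that by auto
  then have "(\<lambda>y. sqrt (pseudodist_sq x y)) ` (ball 0 1 - {x}) \<subseteq> {0<..<1}" by blast
  ultimately show ?thesis
    unfolding hyp_green_eq by (rule continuous_on_compose2)
qed

lemma continuous_on_hyp_green_deriv:
  fixes x e :: "real ^ 'n"
  assumes x: "norm x < 1"
  shows "continuous_on (ball 0 1 - {x}) (\<lambda>y. hyp_green_deriv x y e)"
proof -
  have b: "bracket x y \<noteq> 0" if "y \<in> ball 0 1 - {x}" for y
    using bracket_pos[of x y] x that by auto
  have s: "continuous_on (ball 0 1 - {x}) (\<lambda>y. pseudodist_sq x y)"
    using continuous_on_subset[OF continuous_on_pseudodist_sq[OF x]] by auto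
  have "continuous_on (ball 0 1 - {x}) (\<lambda>y. pseudodist_sq_deriv x y e)"
    unfolding pseudodist_sq_deriv_def using b unfolding bracket_def
    by (intro continuous_intros) auto
  then show ?thesis
    unfolding hyp_green_deriv_def using s pseudodist_sq_bounds[OF x]
    by (intro continuous_intros) fastforce+
qed

lemma partial_derivative_hyp_green:
  fixes x y :: "real ^ 'n"
  assumes "norm x < 1" "norm y < 1" "x \<noteq> y"
  shows "partial_derivative k (\<lambda>z. hyp_green z y) x = hyp_green_deriv x y (axis k 1)"
  unfolding partial_derivative_def
  using has_derivative_hyp_green[OF assms]
  by (intro vector_derivative_at) (simp add: has_real_derivative_iff_has_vector_derivative)

text \<open>The kernels are continuous off the pole \<open>x\<close>, and one point does not affect measurability.\<close>

lemma kernel_scaleR_measurable: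
  fixes k :: "real ^ 'n \<Rightarrow> real" and \<psi> :: "real ^ 'n \<Rightarrow> real ^ 'n"
  assumes "continuous_on (ball 0 1 - {x}) k" "continuous_on (ball 0 1) \<psi>"
  shows "(\<lambda>y. indicator (ball 0 1) y *\<^sub>R (k y *\<^sub>R \<psi> y)) \<in> borel_measurable borel"
proof (rule measurable_discrete_difference)
  have "continuous_on (ball 0 1 - {x}) (\<lambda>y. k y *\<^sub>R \<psi> y)"
    using assms continuous_on_subset[OF assms(2)] by (intro continuous_intros) auto
  then show "(\<lambda>y. indicator (ball 0 1 - {x}) y *\<^sub>R (k y *\<^sub>R \<psi> y)) \<in> borel_measurable borel"
    by (intro borel_measurable_continuous_on_indicator) auto
  show "countable {x}" by simp
qed (auto simp: indicator_def)

section \<open>Differentiation of the Green potential\<close>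

text \<open>The inequalities \<open>a \<le> b\<close> and \<open>p \<le> 2 b\<close> together give \<open>p max(1, a/p) \<le> 2 b\<close>, which turns \<open>b^(1-n)\<close> into the cutoff of
  the kernel at scale \<open>p\<close>. The powers of \<open>p\<close> add up to exactly \<open>-n\<close>, so the integral over \<open>y\<close> is
  scale invariant.\<close>

lemma abs_hyp_green_deriv_le_cutoff_kernel:
  fixes x y e :: "real ^ 'n"
  assumes n: "CARD('n) \<ge> 2" and x: "norm x < 1" and y: "norm y < 1" and xy: "x \<noteq> y"
    and e: "norm e = 1"
  shows "\<bar>hyp_green_deriv x y e\<bar> \<le> (1 - (norm y)\<^sup>2) ^ (CARD('n) - 1)
    * (6 * 2 ^ (CARD('n) - 1) / (1 - (norm x)\<^sup>2) ^ CARD('n) * cutoff_kernel ((y - x) /\<^sub>R (1 - (norm x)\<^sup>2)))"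
proof -
  define m where "m = CARD('n) - 2"
  have m: "CARD('n) = m + 2" using n by (simp add: m_def)
  define a where "a = norm (x - y)"
  define b where "b = bracket x y"
  define p where "p = 1 - (norm x)\<^sup>2"
  define q where "q = 1 - (norm y)\<^sup>2"
  have a: "0 < a" and b: "0 < b" and p: "0 < p" and q: "0 < q" and ab: "a \<le> b" and pb: "p \<le> 2 * b"
    using bracket_pos[of x y] one_minus_norm_power2_pos[of x] one_minus_norm_power2_pos[of y]
      norm_diff_le_bracket[of x y] one_minus_norm_power2_le_bracket[of x y] x y xy
    by (simp_all add: a_def b_def p_def q_def)
  have "p * max 1 (a / p) \<le> 2 * b" using ab pb p b by (simp add: max_def)
  then have "(p * max 1 (a / p)) ^ (m + 1) \<le> (2 * b) ^ (m + 1)"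
    using p by (intro power_mono) auto
  then have "p ^ (m + 1) * max 1 (a / p) ^ (m + 1) \<le> 2 ^ (m + 1) * b ^ (m + 1)"
    by (simp only: power_mult_distrib)
  then have max_le: "1 / b ^ (m + 1) \<le> 2 ^ (m + 1) / (p ^ (m + 1) * max 1 (a / p) ^ (m + 1))"
    using b p by (simp add: field_simps less_max_iff_disj del: power_Suc)
  have "norm ((y - x) /\<^sub>R p) = a / p"
    using p by (simp add: a_def norm_minus_commute divide_inverse_commute)
  then have W: "cutoff_kernel ((y - x) /\<^sub>R p) = p ^ (m + 1) / (a ^ (m + 1) * max 1 (a / p) ^ (m + 1))"
    by (simp add: cutoff_kernel_def m power_divide del: power_Suc)
  have "\<bar>hyp_green_deriv x y e\<bar> \<le> 6 * p ^ m * q ^ (m + 1) / (b ^ (m + 1) * a ^ (m + 1))"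
    using abs_hyp_green_deriv_le[OF n x y xy e] by (simp add: m a_def b_def p_def q_def)
  also have "\<dots> = 6 * p ^ m * q ^ (m + 1) / a ^ (m + 1) * (1 / b ^ (m + 1))" by simp
  also have "\<dots> \<le> 6 * p ^ m * q ^ (m + 1) / a ^ (m + 1)
      * (2 ^ (m + 1) / (p ^ (m + 1) * max 1 (a / p) ^ (m + 1)))"
    using a p q by (intro mult_left_mono[OF max_le]) auto
  also have "\<dots> = q ^ (m + 1) * (6 * 2 ^ (m + 1) / p ^ (m + 2) * cutoff_kernel ((y - x) /\<^sub>R p))"
    unfolding W using a p by (simp add: field_simps less_max_iff_disj)
  finally show ?thesis by (simp add: m p_def q_def)
qed

lemma AE_lborel_neq: "AE y in (lborel :: 'a::euclidean_space measure). y \<noteq> x"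
  by (rule AE_lborel_singleton)

text \<open>Integrability of the potential and the uniform bound. For the kernel itself any majorant will do, and its
  constant may depend on \<open>x\<close>; for the derivative the constant is independent of \<open>x\<close> after rescaling.\<close>

lemma
  fixes \<psi> :: "real ^ 'n \<Rightarrow> real ^ 'n" and x :: "real ^ 'n"
  assumes n: "CARD('n) \<ge> 3" and \<psi>: "continuous_on (ball 0 1) \<psi>" and M: "0 \<le> M"
    and bound: "\<And>y. norm y < 1 \<Longrightarrow> norm (\<psi> y) \<le> M * (1 - (norm y)\<^sup>2)"
    and x: "norm x < 1"
  defines "V \<equiv> measure lborel (ball 0 1 :: (real ^ 'n) set)"
  shows set_integrable_hyp_green: "set_integrable tau (ball 0 1) (\<lambda>y. hyp_green x y *\<^sub>R \<psi> y)"
    and set_integrable_hyp_green_deriv: "norm e = 1 \<Longrightarrow> set_integrable tau (ball 0 1) (\<lambda>y. hyp_green_deriv x y e *\<^sub>R \<psi> y)"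
    and norm_integral_hyp_green_deriv_le: "norm e = 1 \<Longrightarrow> norm (LINT y:ball 0 1|tau. hyp_green_deriv x y e *\<^sub>R \<psi> y)
      \<le> M / V * (6 * 2 ^ (CARD('n) - 1) * integral\<^sup>L lborel (cutoff_kernel :: real ^ 'n \<Rightarrow> real))"
proof -
  have W: "integrable lborel (cutoff_kernel :: real ^ 'n \<Rightarrow> real)"
    using n by (intro cutoff_kernel_integrable) simp
  have V: "0 < V" unfolding V_def by (rule measure_unit_ball_pos)
  note mG = kernel_scaleR_measurable[OF continuous_on_hyp_green[OF x] \<psi>]
  have "integrable lborel (\<lambda>y. tau_density y *\<^sub>R (hyp_green x y *\<^sub>R \<psi> y))"
  proof (rule Bochner_Integration.integrable_bound)
    let ?c = "(2 / (1 - norm x)\<^sup>2) ^ (CARD('n) - 1)"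
    let ?H = "\<lambda>y. M / V * (?c * (2 ^ (CARD('n) - 1) * cutoff_kernel ((y - x) /\<^sub>R 1)))"
    show "integrable lborel ?H"
      using lborel_integral_rescale(1)[OF W, of 1 x] by (intro integrable_mult_right) simp
    have pointwise: "norm (tau_density y *\<^sub>R (hyp_green x y *\<^sub>R \<psi> y)) \<le> ?H y" if xy: "y \<noteq> x" for y
    proof (unfold V_def, rule norm_tau_density_scaleR_le)
      assume y: "norm y < 1"
      have "\<bar>hyp_green x y\<bar> \<le> ?c * (1 - (norm y)\<^sup>2) ^ (CARD('n) - 1) * (1 / norm (x - y) ^ (CARD('n) - 1))"
        by (rule abs_hyp_green_le) (use n x y xy in auto)
      also have "\<dots> \<le> ?c * (1 - (norm y)\<^sup>2) ^ (CARD('n) - 1)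
          * (2 ^ (CARD('n) - 1) * cutoff_kernel (y - x))"
        using inverse_power_norm_le_cutoff_kernel[of "y - x"] norm_triangle_ineq4[of y x] x y
          one_minus_norm_power2_pos[OF y]
        by (intro mult_left_mono) (auto simp: norm_minus_commute)
      finally show "\<bar>hyp_green x y\<bar> \<le> (1 - (norm y)\<^sup>2) ^ (CARD('n) - 1)
          * (?c * (2 ^ (CARD('n) - 1) * cutoff_kernel ((y - x) /\<^sub>R 1)))" by (simp add: ac_simps)
    qed (use bound M in \<open>auto simp: cutoff_kernel_nonneg intro!: mult_nonneg_nonneg\<close>)
    show "AE y in lborel. norm (tau_density y *\<^sub>R (hyp_green x y *\<^sub>R \<psi> y)) \<le> norm (?H y)"
      using AE_lborel_neq[of x]
      by eventually_elim (unfold real_norm_def, rule order.trans[OF pointwise abs_ge_self])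
  qed (use set_integral_tau(3)[OF mG] in simp)
  then show "set_integrable tau (ball 0 1) (\<lambda>y. hyp_green x y *\<^sub>R \<psi> y)"
    by (simp only: set_integral_tau(1)[OF mG])
  assume e: "norm e = 1"
  note mD = kernel_scaleR_measurable[OF continuous_on_hyp_green_deriv[OF x] \<psi>, of e]
  let ?p = "1 - (norm x)\<^sup>2"
  let ?H = "\<lambda>y. M / V * (6 * 2 ^ (CARD('n) - 1) / ?p ^ CARD('n) * cutoff_kernel ((y - x) /\<^sub>R ?p))"
  have p: "0 < ?p" by (rule one_minus_norm_power2_pos[OF x])
  have H: "integrable lborel ?H"
    using lborel_integral_rescale(1)[OF W p] by (intro integrable_mult_right)
  have pointwise: "norm (tau_density y *\<^sub>R (hyp_green_deriv x y e *\<^sub>R \<psi> y)) \<le> ?H y" if xy: "y \<noteq> x" for y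
    unfolding V_def
  proof (rule norm_tau_density_scaleR_le)
    assume y: "norm y < 1"
    show "\<bar>hyp_green_deriv x y e\<bar> \<le> (1 - (norm y)\<^sup>2) ^ (CARD('n) - 1)
        * (6 * 2 ^ (CARD('n) - 1) / ?p ^ CARD('n) * cutoff_kernel ((y - x) /\<^sub>R ?p))"
      by (rule abs_hyp_green_deriv_le_cutoff_kernel) (use n x y xy e in auto)
  qed (use bound M p in \<open>auto simp: cutoff_kernel_nonneg intro!: mult_nonneg_nonneg divide_nonneg_nonneg\<close>)
  have bd: "AE y in lborel. norm (tau_density y *\<^sub>R (hyp_green_deriv x y e *\<^sub>R \<psi> y)) \<le> ?H y"
    using AE_lborel_neq[of x] by eventually_elim (rule pointwise)
  have int: "integrable lborel (\<lambda>y. tau_density y *\<^sub>R (hyp_green_deriv x y e *\<^sub>R \<psi> y))"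
  proof (rule Bochner_Integration.integrable_bound[OF H])
    show "AE y in lborel. norm (tau_density y *\<^sub>R (hyp_green_deriv x y e *\<^sub>R \<psi> y)) \<le> norm (?H y)"
      using bd by eventually_elim (simp only: real_norm_def order.trans[OF _ abs_ge_self])
  qed (use set_integral_tau(3)[OF mD] in simp)
  then show "set_integrable tau (ball 0 1) (\<lambda>y. hyp_green_deriv x y e *\<^sub>R \<psi> y)"
    by (simp only: set_integral_tau(1)[OF mD])
  have "norm (LINT y:ball 0 1|tau. hyp_green_deriv x y e *\<^sub>R \<psi> y)
      \<le> (\<integral>y. norm (tau_density y *\<^sub>R (hyp_green_deriv x y e *\<^sub>R \<psi> y)) \<partial>lborel)"
    unfolding set_integral_tau(2)[OF mD] by (rule integral_norm_bound)
  also have "\<dots> \<le> integral\<^sup>L lborel ?H"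
    by (rule integral_mono_AE[OF integrable_norm[OF int] H bd])
  also have "\<dots> = M / V * (6 * 2 ^ (CARD('n) - 1) / ?p ^ CARD('n)
      * (?p ^ CARD('n) * integral\<^sup>L lborel (cutoff_kernel :: real ^ 'n \<Rightarrow> real)))"
    using lborel_integral_rescale(2)[OF W p, of x] by simp
  also have "\<dots> = M / V * (6 * 2 ^ (CARD('n) - 1) * integral\<^sup>L lborel (cutoff_kernel :: real ^ 'n \<Rightarrow> real))"
    using p by simp
  finally show "norm (LINT y:ball 0 1|tau. hyp_green_deriv x y e *\<^sub>R \<psi> y)
      \<le> M / V * (6 * 2 ^ (CARD('n) - 1) * integral\<^sup>L lborel (cutoff_kernel :: real ^ 'n \<Rightarrow> real))" .
qed

text \<open>Dominated convergence for the difference quotients along a null sequence, with the moving majorants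
  \<open>W(y - x) + W(y - x - t e)\<close>. Steps are restricted to half the distance from \<open>x\<close> to the sphere, which keeps
  the points \<open>x + t e\<close> in a fixed smaller ball.\<close>

lemma green_potential_has_vector_derivative:
  fixes \<psi> :: "real ^ 'n \<Rightarrow> real ^ 'n" and x e :: "real ^ 'n"
  assumes n: "CARD('n) \<ge> 3" and \<psi>: "continuous_on (ball 0 1) \<psi>" and M: "0 \<le> M"
    and bound: "\<And>y. norm y < 1 \<Longrightarrow> norm (\<psi> y) \<le> M * (1 - (norm y)\<^sup>2)"
    and x: "norm x < 1" and e: "norm e = 1"
  shows "((\<lambda>t. green_potential \<psi> (x + t *\<^sub>R e)) has_vector_derivative
     (LINT y:ball 0 1|tau. hyp_green_deriv x y e *\<^sub>R \<psi> y)) (at 0)"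
proof -
  have W: "integrable lborel (cutoff_kernel :: real ^ 'n \<Rightarrow> real)"
    using n by (intro cutoff_kernel_integrable) simp
  define V where "V = measure lborel (ball 0 1 :: (real ^ 'n) set)"
  have V: "0 < V" unfolding V_def by (rule measure_unit_ball_pos)
  define \<delta> where "\<delta> = (1 - norm x) / 2"
  have \<delta>: "0 < \<delta>" using x by (simp add: \<delta>_def)
  have x\<delta>: "norm x \<le> 1 - \<delta>" using x by (simp add: \<delta>_def field_simps)
  let ?u = "\<lambda>t. green_potential \<psi> (x + t *\<^sub>R e)"
  let ?v = "LINT y:ball 0 1|tau. hyp_green_deriv x y e *\<^sub>R \<psi> y"
  note mG = kernel_scaleR_measurable[OF continuous_on_hyp_green \<psi>]
  note mD = kernel_scaleR_measurable[OF continuous_on_hyp_green_deriv[OF x] \<psi>, of e]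
  have "((\<lambda>t. (?u t - ?u 0) /\<^sub>R t) \<longlongrightarrow> ?v) (at 0 within {-\<delta><..<\<delta>})"
    unfolding tendsto_at_iff_sequentially comp_def
  proof (intro allI impI)
    fix X :: "nat \<Rightarrow> real" assume "\<forall>i. X i \<in> {-\<delta><..<\<delta>} - {0}" and X: "X \<longlonglongrightarrow> 0"
    then have "- \<delta> < X i \<and> X i < \<delta>" and X_neq: "X i \<noteq> 0" for i by auto
    then have X_small: "\<bar>X i\<bar> < \<delta>" for i by (metis abs_less_iff minus_less_iff)
    define w where "w i = x + X i *\<^sub>R e" for i
    have w\<delta>: "norm (w i) \<le> 1 - \<delta>" for i
    proof -
      have "norm (w i) \<le> norm x + \<bar>X i\<bar>" unfolding w_def using norm_triangle_ineq[of x "X i *\<^sub>R e"] e by simp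
      then show ?thesis using X_small[of i] by (simp add: \<delta>_def field_simps)
    qed
    then have w: "norm (w i) < 1" for i using \<delta> by (smt (verit))
    have w_lim: "w \<longlonglongrightarrow> x"
      unfolding w_def using tendsto_add[OF tendsto_const tendsto_scaleR[OF X tendsto_const], of x e] by simp
    define C where "C = 24 * 2 ^ (CARD('n) - 1) / (\<delta> ^ 3 * (\<delta>\<^sup>2) ^ (CARD('n) - 2))"
    have C: "0 \<le> C" using \<delta> by (simp add: C_def)
    define D where "D = M / V * (C * 2 ^ (CARD('n) - 1))"
    define F where "F i y = tau_density y *\<^sub>R (((hyp_green (w i) y - hyp_green x y) / X i) *\<^sub>R \<psi> y)" for i y
    define H where "H i y = D * (cutoff_kernel (y - x) + cutoff_kernel (y - w i))" for i y
    have shift: "integrable lborel (\<lambda>y. cutoff_kernel (y - z))"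
      "(\<integral>y. cutoff_kernel (y - z) \<partial>lborel) = integral\<^sup>L lborel (cutoff_kernel :: real ^ 'n \<Rightarrow> real)"
      for z :: "real ^ 'n"
      using lborel_integral_rescale[OF W, of 1 z] by simp_all
    have u_int: "integrable lborel (\<lambda>y. tau_density y *\<^sub>R (hyp_green z y *\<^sub>R \<psi> y))"
      and u_eq: "green_potential \<psi> z = (\<integral>y. tau_density y *\<^sub>R (hyp_green z y *\<^sub>R \<psi> y) \<partial>lborel)"
      if z: "norm z < 1" for z
      using set_integrable_hyp_green[OF n \<psi> M bound z] set_integral_tau(1,2)[OF mG[OF z]]
      by (simp_all only: green_potential_def)
    have F_alt: "F i = (\<lambda>y. (tau_density y *\<^sub>R (hyp_green (w i) y *\<^sub>R \<psi> y)
        - tau_density y *\<^sub>R (hyp_green x y *\<^sub>R \<psi> y)) /\<^sub>R X i)" for i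
      by (rule ext) (simp add: F_def algebra_simps divide_inverse)
    have F_int: "integral\<^sup>L lborel (F i) = (?u (X i) - ?u 0) /\<^sub>R X i" for i
      unfolding F_alt using u_int[OF w] u_int[OF x] u_eq[OF w] u_eq[OF x]
      by (simp add: w_def)
    have "(\<lambda>i. integral\<^sup>L lborel (F i)) \<longlonglongrightarrow> (\<integral>y. tau_density y *\<^sub>R (hyp_green_deriv x y e *\<^sub>R \<psi> y) \<partial>lborel)"
    proof (rule generalized_dominated_convergence(2))
      show "F i \<in> borel_measurable lborel" for i
        unfolding F_alt
        by (intro borel_measurable_integrable integrable_scaleR_right Bochner_Integration.integrable_diff
            u_int w x)
      show "(\<lambda>y. tau_density y *\<^sub>R (hyp_green_deriv x y e *\<^sub>R \<psi> y)) \<in> borel_measurable lborel"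
        using set_integral_tau(3)[OF mD] by simp
      show "integrable lborel (H i)" for i
        unfolding H_def using shift by simp
      show "integrable lborel (\<lambda>y. D * (cutoff_kernel (y - x) + cutoff_kernel (y - x)))"
        using shift by simp
      show "integral\<^sup>L lborel (H i) = (\<integral>y. D * (cutoff_kernel (y - x) + cutoff_kernel (y - x)) \<partial>lborel)" for i
        unfolding H_def using shift by simp
      have D: "0 \<le> D" using M V C by (simp add: D_def)
      show "0 \<le> H i y" "0 \<le> D * (cutoff_kernel (y - x) + cutoff_kernel (y - x))" for i y
        using D by (simp_all add: H_def cutoff_kernel_nonneg)
      show "AE y in lborel. (\<lambda>i. H i y) \<longlonglongrightarrow> D * (cutoff_kernel (y - x) + cutoff_kernel (y - x))"
        using AE_lborel_neq[of x]
      proof eventually_elim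
        case (elim y)
        have "(\<lambda>i. cutoff_kernel (y - w i)) \<longlonglongrightarrow> cutoff_kernel (y - x)"
          using elim by (intro isCont_tendsto_compose[OF isCont_cutoff_kernel] tendsto_intros w_lim) auto
        then show ?case unfolding H_def by (intro tendsto_intros)
      qed
      show "AE y in lborel. (\<lambda>i. F i y) \<longlonglongrightarrow> tau_density y *\<^sub>R (hyp_green_deriv x y e *\<^sub>R \<psi> y)"
        using AE_lborel_neq[of x]
      proof eventually_elim
        case (elim y)
        show ?case
        proof (cases "norm y < 1")
          case True
          have "((\<lambda>t. (hyp_green (x + t *\<^sub>R e) y - hyp_green x y) / t) \<longlongrightarrow> hyp_green_deriv x y e) (at 0)"
            using has_derivative_hyp_green[OF x True, of e] elim by (simp add: DERIV_def)
          then have "(\<lambda>i. (hyp_green (w i) y - hyp_green x y) / X i) \<longlonglongrightarrow> hyp_green_deriv x y e"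
            unfolding w_def by (rule filterlim_compose) (use X X_neq in \<open>simp add: filterlim_at\<close>)
          then show ?thesis unfolding F_def by (intro tendsto_intros)
        next
          case False
          then show ?thesis by (simp add: F_def tau_density_def)
        qed
      qed
      show "AE y in lborel. norm (F i y) \<le> H i y" for i
        using AE_lborel_neq[of x] AE_lborel_neq[of "w i"]
      proof eventually_elim
        case (elim y)
        let ?N = "CARD('n) - 1"
        have "norm (F i y) \<le> M / V * (C * 2 ^ ?N * (cutoff_kernel (y - x) + cutoff_kernel (y - w i)))"
          unfolding F_def V_def
        proof (rule norm_tau_density_scaleR_le)
          assume y: "norm y < 1"
          have near: "1 / norm (z - y) ^ ?N \<le> 2 ^ ?N * cutoff_kernel (y - z)" if "norm z < 1" for z
            using inverse_power_norm_le_cutoff_kernel[of "y - z"] norm_triangle_ineq4[of y z] that y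
            by (simp add: norm_minus_commute)
          have "\<bar>hyp_green (w i) y - hyp_green x y\<bar> \<le> C * \<bar>X i\<bar> * (1 - (norm y)\<^sup>2) ^ ?N
              * (1 / norm (x - y) ^ ?N + 1 / norm (w i - y) ^ ?N)"
            unfolding C_def w_def
            by (rule abs_hyp_green_diff_le[OF \<delta> x\<delta>])
              (use w\<delta>[of i] y e elim n in \<open>auto simp: w_def\<close>)
          also have "\<dots> \<le> C * \<bar>X i\<bar> * (1 - (norm y)\<^sup>2) ^ ?N
              * (2 ^ ?N * cutoff_kernel (y - x) + 2 ^ ?N * cutoff_kernel (y - w i))"
            using C one_minus_norm_power2_pos[OF y]
            by (intro mult_left_mono add_mono near x w) auto
          finally show "\<bar>(hyp_green (w i) y - hyp_green x y) / X i\<bar> \<le> (1 - (norm y)\<^sup>2) ^ ?N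
              * (C * 2 ^ ?N * (cutoff_kernel (y - x) + cutoff_kernel (y - w i)))"
            using X_neq[of i] by (simp add: abs_divide pos_divide_le_eq algebra_simps)
        qed (use bound M C in \<open>auto simp: cutoff_kernel_nonneg\<close>)
        then show ?case by (simp add: H_def D_def mult.assoc)
      qed
    qed
    then show "(\<lambda>i. (?u (X i) - ?u 0) /\<^sub>R X i) \<longlonglongrightarrow> ?v"
      by (simp only: F_int set_integral_tau(2)[OF mD])
  qed
  moreover have "at (0::real) within {-\<delta><..<\<delta>} = at 0"
    using \<delta> by (intro at_within_open) auto
  ultimately show ?thesis by (intro has_vector_derivative_if_quotient_tendsto) simp
qed

theorem proposition4p5:
  fixes M :: real
  assumes "CARD('n::finite) \<ge> 3"
  shows "\<exists>\<beta>\<^sub>1::real. \<forall>\<psi> :: real ^ 'n \<Rightarrow> real ^ 'n.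
    continuous_on (ball 0 1) \<psi> \<longrightarrow>
    (\<forall>x\<in>ball 0 1. norm (\<psi> x) \<le> M * (1 - (norm x)\<^sup>2)) \<longrightarrow>
    (\<forall>k. \<forall>x\<in>ball 0 1.
      set_integrable tau (ball 0 1) (\<lambda>y. hyp_green x y *\<^sub>R \<psi> y) \<and>
      set_integrable tau (ball 0 1)
        (\<lambda>y. partial_derivative k (\<lambda>z. hyp_green z y) x *\<^sub>R \<psi> y) \<and>
      has_partial_derivative k (green_potential \<psi>) x \<and>
      partial_derivative k (green_potential \<psi>) x =
        (LINT y:ball 0 1|tau. partial_derivative k (\<lambda>z. hyp_green z y) x *\<^sub>R \<psi> y) \<and>
      norm (partial_derivative k (green_potential \<psi>) x) \<le> \<beta>\<^sub>1)"
proof (intro exI allI impI ballI)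
  fix \<psi> :: "real ^ 'n \<Rightarrow> real ^ 'n" and k :: 'n and x :: "real ^ 'n"
  assume \<psi>: "continuous_on (ball 0 1) \<psi>"
    and bd: "\<forall>x\<in>ball 0 1. norm (\<psi> x) \<le> M * (1 - (norm x)\<^sup>2)" and "x \<in> ball 0 1"
  then have x: "norm x < 1" and bound: "\<And>y. norm y < 1 \<Longrightarrow> norm (\<psi> y) \<le> M * (1 - (norm y)\<^sup>2)"
    by auto
  \<comment> \<open>The hypothesis at the centre forces the sign of the constant.\<close>
  have M: "0 \<le> M" using bound[of 0] norm_ge_zero[of "\<psi> 0"] by (simp del: norm_ge_zero)
  have e: "norm (axis k 1 :: real ^ 'n) = 1" by simp
  \<comment> \<open>The two integrands agree except at the pole, where the partial derivative has no meaningful value.\<close>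
  let ?\<D> = "\<lambda>y. partial_derivative k (\<lambda>z. hyp_green z y) x *\<^sub>R \<psi> y"
  let ?\<D>' = "\<lambda>y. hyp_green_deriv x y (axis k 1) *\<^sub>R \<psi> y"
  have eq: "partial_derivative k (\<lambda>z. hyp_green z y) x = hyp_green_deriv x y (axis k 1)"
    if "y \<in> ball 0 1 - {x}" for y
    using partial_derivative_hyp_green[OF x] that by auto
  have c: "continuous_on (ball 0 1 - {x}) (\<lambda>y. partial_derivative k (\<lambda>z. hyp_green z y) x)"
    by (rule continuous_on_eq[OF continuous_on_hyp_green_deriv[OF x]]) (rule eq[symmetric])
  note m = kernel_scaleR_measurable[OF c \<psi>]
    and m' = kernel_scaleR_measurable[OF continuous_on_hyp_green_deriv[OF x] \<psi>, of "axis k 1"]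
  have ae: "AE y in lborel. tau_density y *\<^sub>R ?\<D> y = tau_density y *\<^sub>R ?\<D>' y"
    using AE_lborel_neq[of x]
  proof eventually_elim
    case (elim y)
    then show ?case using eq[of y] by (cases "y \<in> ball 0 1") (auto simp: tau_density_def)
  qed
  note meas = set_integral_tau(3)[OF m] set_integral_tau(3)[OF m']
  have "set_integrable tau (ball 0 1) ?\<D> \<longleftrightarrow> set_integrable tau (ball 0 1) ?\<D>'"
    unfolding set_integral_tau(1)[OF m] set_integral_tau(1)[OF m']
    using meas ae by (intro integrable_cong_AE) auto
  then have int: "set_integrable tau (ball 0 1) ?\<D>"
    using set_integrable_hyp_green_deriv[OF assms \<psi> M bound x e] by simp
  have lint: "(LINT y:ball 0 1|tau. ?\<D> y) = (LINT y:ball 0 1|tau. ?\<D>' y)"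
    unfolding set_integral_tau(2)[OF m] set_integral_tau(2)[OF m']
    using meas ae by (intro integral_cong_AE) auto
  note deriv = green_potential_has_vector_derivative[OF assms \<psi> M bound x e]
  then have part: "partial_derivative k (green_potential \<psi>) x = (LINT y:ball 0 1|tau. ?\<D>' y)"
    unfolding partial_derivative_def by (rule vector_derivative_at)
  have has: "has_partial_derivative k (green_potential \<psi>) x"
    unfolding has_partial_derivative_def using deriv by (rule differentiableI_vector)
  show "set_integrable tau (ball 0 1) (\<lambda>y. hyp_green x y *\<^sub>R \<psi> y) \<and>
      set_integrable tau (ball 0 1)
        (\<lambda>y. partial_derivative k (\<lambda>z. hyp_green z y) x *\<^sub>R \<psi> y) \<and>
      has_partial_derivative k (green_potential \<psi>) x \<and>
      partial_derivative k (green_potential \<psi>) x =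
        (LINT y:ball 0 1|tau. partial_derivative k (\<lambda>z. hyp_green z y) x *\<^sub>R \<psi> y) \<and>
      norm (partial_derivative k (green_potential \<psi>) x) \<le> M / measure lborel (ball 0 1 :: (real ^ 'n) set)
        * (6 * 2 ^ (CARD('n) - 1) * integral\<^sup>L lborel (cutoff_kernel :: real ^ 'n \<Rightarrow> real))"
    using set_integrable_hyp_green[OF assms \<psi> M bound x] int has part lint
      norm_integral_hyp_green_deriv_le[OF assms \<psi> M bound x e] by auto
qed

end
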